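(* Let $\beta\ge0$, $L\in2\mathbb{N}$ (positive even), $S\in\frac12\mathbb{N}$ (positive), $d\ge2$, $u\in[-1,0]$ and $i\in\{1,\dots,d\}$. For any $z\in\mathbb{T}_L\setminus\{o\}$, $$\langle S^3_oS^3_z\rangle\le\begin{cases}\langle S^3_oS^3_{(z\cdot\boldsymbol{e}_i)\boldsymbol{e}_i}\rangle&\text{if } z\cdot\boldsymbol{e}_i\in2\mathbb{N}+1,\\[2pt] \frac12\Big(\langle S^3_oS^3_{(z\cdot\boldsymbol{e}_i+1)\boldsymbol{e}_i}\rangle+\langle S^3_oS^3_{(z\cdot\boldsymbol{e}_i-1)\boldsymbol{e}_i}\rangle\Big)&\text{if } z\cdot\boldsymbol{e}_i\in2\mathbb{N}\setminus\{0\}.\end{cases}$$ Further, for $y\in\mathbb{T}_L$ such that $y\cdot\boldsymbol{e}_i=0$ (for example $y=o$), the function $$n\mapsto\langle S^3_oS^3_{y+n\boldsymbol{e}_i}\rangle+\langle S^3_oS^3_{n\boldsymbol{e}_i}\rangle$$ is a non-increasing function of $n$ for odd $n\in(0,L/2)$.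
   Context: $\mathbb{T}_L=\mathbb{Z}^d/L\mathbb{Z}^d$ is the torus with origin $o$, $\boldsymbol{e}_1,\dots,\boldsymbol{e}_d$ are the standard unit vectors, $\mathcal{E}_L$ is the set of (unordered) edges connecting nearest-neighbour vertices of $\mathbb{T}_L$; coordinates $z\cdot\boldsymbol{e}_i$ are represented in $\{0,1,\dots,L-1\}$, and $\mathbb{N}$ contains $0$ in expressions such as $2\mathbb{N}+1$. The spin-$S$ operators $S^1,S^2,S^3$ are the Hermitian matrices on $\mathbb{C}^{2S+1}$ with $[S^1,S^2]=\mathrm{i}S^3$, $[S^2,S^3]=\mathrm{i}S^1$, $[S^3,S^1]=\mathrm{i}S^2$ and $(S^1)^2+(S^2)^2+(S^3)^2=S(S+1)\mathbf{1}$; each has spectrum $\{-S,-S+1,\dots,S\}$. On $\otimes_{x\in\mathbb{T}_L}\mathbb{C}^{2S+1}$, $S^j_x=S^j\otimes\mathbf{1}_{\mathbb{T}_L\setminus\{x\}}$ acts as $S^j$ on the factor at $x$ and as the identity elsewhere. The Hamiltonian is $$H_u=-2\sum_{\{x,y\}\in\mathcal{E}_L}\big(S^1_xS^1_y+uS^2_xS^2_y+S^3_xS^3_y\big),$$ and the Gibbs state at inverse temperature $\beta$ is $\langle A\rangle=\frac{1}{Z_u(\beta)}\operatorname{Tr}\big(A\,e^{-\beta H_u}\big)$, $Z_u(\beta)=\operatorname{Tr}e^{-\beta H_u}$. *)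

theory Defs
  imports
    "HOL-Analysis.Analysis"
    "HOL-Library.Complex_Order"
    "Berlekamp_Zassenhaus.Finite_Field"
begin

(* Conventions.
   - The spin space C^(2S+1) is complex^'s with CARD('s) = 2S+1.
   - The torus Z^d / L Z^d is ('l mod_ring)^'d with CARD('d) = d and CARD('l) = L.  The class
     nontriv means L >= 2, which every positive even L satisfies.  e_i is axis i 1, the origin is 0,
     and to_int_mod_ring (z $ i) is the representative of z.e_i in {0,...,L-1}.
   - The tensor product over a finite set 'v of copies of complex^'s is complex^('v => 's): its
     standard basis is indexed by the configurations 'v => 's.
   - The product of matrices is "**"; "*" on vectors would be the componentwise product. *)

type_synonym 'n cmatrix = "complex ^ 'n ^ 'n"

definition hermitian :: "'n::finite cmatrix \<Rightarrow> bool" where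
  "hermitian A \<longleftrightarrow> (\<forall>a b. A $ a $ b = cnj (A $ b $ a))"

definition commutator :: "'n::finite cmatrix \<Rightarrow> 'n cmatrix \<Rightarrow> 'n cmatrix" where
  "commutator A B = A ** B - B ** A"

(* mat c is c times the identity matrix. *)
definition spin_operators ::
    "real \<Rightarrow> 's::finite cmatrix \<Rightarrow> 's cmatrix \<Rightarrow> 's cmatrix \<Rightarrow> bool" where
  "spin_operators S S1 S2 S3 \<longleftrightarrow>
     hermitian S1 \<and> hermitian S2 \<and> hermitian S3 \<and>
     commutator S1 S2 = mat \<i> ** S3 \<and>
     commutator S2 S3 = mat \<i> ** S1 \<and>
     commutator S3 S1 = mat \<i> ** S2 \<and>
     S1 ** S1 + S2 ** S2 + S3 ** S3 = mat (complex_of_real (S * (S + 1)))"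

(* A at the tensor factor x and the identity at every other factor, as matrix entries in the
   configuration basis. *)
definition site_op :: "'s::finite cmatrix \<Rightarrow> 'v::finite \<Rightarrow> ('v \<Rightarrow> 's) cmatrix" where
  "site_op A x = (\<chi> \<sigma> \<tau>. A $ \<sigma> x $ \<tau> x * (\<Prod>y\<in>UNIV - {x}. if \<sigma> y = \<tau> y then 1 else 0))"

(* Unordered edges; for L = 2 the two steps in direction i give the same edge. *)
definition torus_edges :: "('l::nontriv mod_ring ^ 'd::finite) set set" where
  "torus_edges = {{x, x + axis i 1} | x i. True}"

definition exchange ::
    "'s::finite cmatrix \<Rightarrow> 's cmatrix \<Rightarrow> 's cmatrix \<Rightarrow> real \<Rightarrow> 'v::finite \<Rightarrow> 'v \<Rightarrow> ('v \<Rightarrow> 's) cmatrix" where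
  "exchange S1 S2 S3 u x y =
     site_op S1 x ** site_op S1 y + u *\<^sub>R (site_op S2 x ** site_op S2 y)
       + site_op S3 x ** site_op S3 y"

(* The exchange term of an unordered edge, as the mean over its two orderings.  Both orderings give
   the same operator: see edge_exchange_doubleton. *)
definition edge_exchange ::
    "'s::finite cmatrix \<Rightarrow> 's cmatrix \<Rightarrow> 's cmatrix \<Rightarrow> real \<Rightarrow> 'v::finite set \<Rightarrow> ('v \<Rightarrow> 's) cmatrix" where
  "edge_exchange S1 S2 S3 u e = (1/2) *\<^sub>R (\<Sum>x\<in>e. \<Sum>y\<in>e - {x}. exchange S1 S2 S3 u x y)"

definition hamiltonian ::
    "'s::finite cmatrix \<Rightarrow> 's cmatrix \<Rightarrow> 's cmatrix \<Rightarrow> real \<Rightarrow>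
     (('l::nontriv mod_ring ^ 'd::finite) \<Rightarrow> 's) cmatrix" where
  "hamiltonian S1 S2 S3 u = - 2 *\<^sub>R (\<Sum>e\<in>torus_edges. edge_exchange S1 S2 S3 u e)"

definition matrix_exp :: "'n::finite cmatrix \<Rightarrow> 'n cmatrix" where
  "matrix_exp A = (\<Sum>k. (1 / fact k) *\<^sub>R (((**) A ^^ k) (mat 1)))"

definition partition_function :: "real \<Rightarrow> 'n::finite cmatrix \<Rightarrow> complex" where
  "partition_function \<beta> H = trace (matrix_exp ((- \<beta>) *\<^sub>R H))"

definition gibbs_state :: "real \<Rightarrow> 'n::finite cmatrix \<Rightarrow> 'n cmatrix \<Rightarrow> complex" where
  "gibbs_state \<beta> H A = trace (A ** matrix_exp ((- \<beta>) *\<^sub>R H)) / partition_function \<beta> H"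

(* The two-point function z |-> <S3_o S3_z>. Its values are complex numbers here; the order of
   Complex_Order on them (equal imaginary parts, ordered real parts) is the order of the reals
   on real values. *)
definition spin_corr ::
    "'s::finite cmatrix \<Rightarrow> 's cmatrix \<Rightarrow> 's cmatrix \<Rightarrow> real \<Rightarrow> real \<Rightarrow>
     'l::nontriv mod_ring ^ 'd::finite \<Rightarrow> complex" where
  "spin_corr S1 S2 S3 u \<beta> z =
     gibbs_state \<beta> (hamiltonian S1 S2 S3 u) (site_op S3 0 ** site_op S3 z)"

lemma site_op_nth:
  "site_op A x $ \<sigma> $ \<tau> = (if \<forall>y. y \<noteq> x \<longrightarrow> \<sigma> y = \<tau> y then A $ \<sigma> x $ \<tau> x else 0)"
proof (cases "\<forall>y. y \<noteq> x \<longrightarrow> \<sigma> y = \<tau> y")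
  case True
  then show ?thesis by (simp add: site_op_def)
next
  case False
  then obtain y where "y \<noteq> x" "\<sigma> y \<noteq> \<tau> y" by blast
  then have "(\<Prod>y\<in>UNIV - {x}. if \<sigma> y = \<tau> y then 1 else 0) = (0::complex)"
    by (intro prod_zero) auto
  with False show ?thesis by (simp only: site_op_def vec_lambda_beta) simp
qed

lemma site_op_mult_nth:
  assumes "x \<noteq> y"
  shows "(site_op A x ** site_op B y) $ \<sigma> $ \<tau> =
    (if \<forall>w. w \<noteq> x \<and> w \<noteq> y \<longrightarrow> \<sigma> w = \<tau> w then A $ \<sigma> x $ \<tau> x * B $ \<sigma> y $ \<tau> y else 0)"
proof -
  let ?r = "\<sigma>(x := \<tau> x)"
  have *: "site_op A x $ \<sigma> $ \<rho> * site_op B y $ \<rho> $ \<tau> = 0" if "\<rho> \<noteq> ?r" for \<rho>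
  proof (rule ccontr)
    assume "\<not> ?thesis"
    then have "\<forall>w. w \<noteq> x \<longrightarrow> \<sigma> w = \<rho> w" "\<forall>w. w \<noteq> y \<longrightarrow> \<rho> w = \<tau> w"
      by (auto simp: site_op_nth split: if_splits)
    with assms have "\<rho> = ?r" by (auto simp: fun_eq_iff)
    with that show False by simp
  qed
  have "(site_op A x ** site_op B y) $ \<sigma> $ \<tau> = (\<Sum>\<rho>\<in>UNIV. site_op A x $ \<sigma> $ \<rho> * site_op B y $ \<rho> $ \<tau>)"
    by (simp add: matrix_matrix_mult_def)
  also have "\<dots> = (\<Sum>\<rho>\<in>{?r}. site_op A x $ \<sigma> $ \<rho> * site_op B y $ \<rho> $ \<tau>)"
    by (intro sum.mono_neutral_right) (use * in auto)
  also have "\<dots> = (if \<forall>w. w \<noteq> x \<and> w \<noteq> y \<longrightarrow> \<sigma> w = \<tau> w then A $ \<sigma> x $ \<tau> x * B $ \<sigma> y $ \<tau> y else 0)"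
    using assms by (auto simp: site_op_nth)
  finally show ?thesis .
qed

lemma site_op_commute: "x \<noteq> y \<Longrightarrow> site_op A x ** site_op B y = site_op B y ** site_op A x"
  by (auto simp: vec_eq_iff site_op_mult_nth)

lemma edge_exchange_doubleton:
  assumes "x \<noteq> y"
  shows "edge_exchange S1 S2 S3 u {x, y} = exchange S1 S2 S3 u x y"
proof -
  have "exchange S1 S2 S3 u y x = exchange S1 S2 S3 u x y"
    using assms by (simp add: exchange_def site_op_commute[of y x])
  moreover have "{x, y} - {x} = {y}" "{x, y} - {y} = {x}" using assms by auto
  ultimately show ?thesis
    using assms by (simp add: edge_exchange_def scaleR_2[symmetric])
qed

end

theory Submission
  imports Defs
begin

text \<open>In a basis of \<open>S\<^sup>3\<close>-eigenvectors obtained by lowering a highest weight vector, the matrices of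
  \<open>S\<^sup>1\<close>, \<open>\<i> S\<^sup>2\<close> and \<open>S\<^sup>3\<close> are real. For \<open>u \<le> 0\<close> the interaction
  \<open>S\<^sup>1 S\<^sup>1 + \<bar>u\<bar> (\<i> S\<^sup>2) (\<i> S\<^sup>2) + S\<^sup>3 S\<^sup>3\<close> across a reflection plane through edges is then of the form
  \<open>\<Sum> C \<theta>(C)\<close> with real \<open>C\<close> in one half of the torus, so the Gibbs state is reflection positive:
  \<open>\<langle>A \<theta>(A)\<rangle> \<ge> 0\<close>. With \<open>A = S\<^sup>3\<^sub>x - S\<^sup>3\<^sub>y\<close> this gives
  \<open>2 G(v + (1 + a + b) e\<^sub>i) \<le> G((1 + 2 a) e\<^sub>i) + G((1 + 2 b) e\<^sub>i)\<close>, whose cases \<open>a = b\<close> and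
  \<open>a = b + 1\<close> are the two site bounds. Four spins give the convexity of
  \<open>n \<mapsto> G(y + n e\<^sub>i) + G(n e\<^sub>i)\<close> on the odd numbers; the function is also symmetric under
  \<open>n \<mapsto> L - n\<close>, hence non-increasing up to \<open>L/2\<close>.\<close>

section \<open>The matrix exponential\<close>

lemma bounded_bilinear_matrix_mult:
  "bounded_bilinear ((**) :: complex^'n^'m \<Rightarrow> complex^'p^'n \<Rightarrow> complex^'p^'m)"
  unfolding bilinear_conv_bounded_bilinear[symmetric] bilinear_def
  by (auto intro!: linearI simp: matrix_add_ldistrib matrix_matrix_mult_def vec_eq_iff
      scaleR_sum_right sum.distrib algebra_simps)

interpretation cmatrix_mult: bounded_bilinear
  "(**) :: complex^'n^'m \<Rightarrow> complex^'p^'n \<Rightarrow> complex^'p^'m"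
  by (rule bounded_bilinear_matrix_mult)

lemma linear_trace: "linear (trace :: complex^'n^'n \<Rightarrow> complex)"
  by (auto intro!: linearI simp: trace_add) (simp add: trace_def scaleR_sum_right)

lemma bounded_linear_trace: "bounded_linear (trace :: complex^'n^'n \<Rightarrow> complex)"
  using linear_trace by (simp add: linear_conv_bounded_linear)

definition matrix_power :: "complex^'n^'n \<Rightarrow> nat \<Rightarrow> complex^'n^'n" where
  "matrix_power A k = ((**) A ^^ k) (mat 1)"

lemma matrix_power_0 [simp]: "matrix_power A 0 = mat 1"
  by (simp add: matrix_power_def)

lemma matrix_power_Suc [simp]: "matrix_power A (Suc k) = A ** matrix_power A k"
  by (simp add: matrix_power_def)

lemma continuous_on_matrix_power: "continuous_on S (\<lambda>A. matrix_power A k)"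
  by (induction k) (auto intro!: continuous_intros cmatrix_mult.continuous_on)

text \<open>One summable majorant serves the whole ball of radius \<open>R\<close>: at a single
  matrix it gives convergence of the exponential series, and its uniformity gives continuity through
  the Weierstrass M-test.\<close>

lemma matrix_exp_uniform_bound:
  "\<exists>M :: nat \<Rightarrow> real. summable M \<and>
    (\<forall>(A :: complex^'n^'n) k. norm A \<le> R \<longrightarrow> norm ((1 / fact k) *\<^sub>R matrix_power A k) \<le> M k)"
proof -
  \<comment> \<open>The norm is that of the vector space of matrices, so a constant \<open>K\<close>
    bounding the bilinear product enters with every power.\<close>
  obtain K where K: "K > 0"
    and le: "\<And>(A :: complex^'n^'n) (B :: complex^'n^'n). norm (A ** B) \<le> norm A * norm B * K"
    using cmatrix_mult.pos_bounded by blast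
  have pow: "norm (matrix_power A k) \<le> (R * K) ^ k * norm (mat 1 :: complex^'n^'n)"
    if A: "norm A \<le> R" for A :: "complex^'n^'n" and k
  proof (induction k)
    case (Suc k)
    have R: "0 \<le> R" using A norm_ge_zero order_trans by blast
    have "norm (matrix_power A (Suc k)) \<le> (norm A * K) * norm (matrix_power A k)"
      using le[of A "matrix_power A k"] by (simp add: mult_ac)
    also have "\<dots> \<le> (R * K) * ((R * K) ^ k * norm (mat 1 :: complex^'n^'n))"
      using A K R Suc by (intro mult_mono) auto
    finally show ?case by (simp add: mult_ac)
  qed simp
  let ?M = "\<lambda>k. inverse (fact k) * (R * K) ^ k * norm (mat 1 :: complex^'n^'n)"
  have "summable ?M"
    by (intro summable_mult2 summable_exp)
  moreover have "norm ((1 / fact k) *\<^sub>R matrix_power A k) \<le> ?M k"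
    if A: "norm A \<le> R" for A :: "complex^'n^'n" and k
    using mult_left_mono[OF pow[OF A], of "inverse (fact k)" k] by (simp add: divide_simps)
  ultimately show ?thesis by blast
qed

lemma matrix_exp_sums:
  fixes A :: "complex^'n^'n"
  shows "(\<lambda>k. (1 / fact k) *\<^sub>R matrix_power A k) sums matrix_exp A"
proof -
  obtain M where M: "summable M"
    "\<And>(B :: complex^'n^'n) k. norm B \<le> norm A \<Longrightarrow> norm ((1 / fact k) *\<^sub>R matrix_power B k) \<le> M k"
    using matrix_exp_uniform_bound[where R="norm A" and 'n='n] by blast
  have "summable (\<lambda>k. (1 / fact k) *\<^sub>R matrix_power A k)"
    by (rule summable_comparison_test'[OF M(1), of 0]) (rule M(2)[OF order_refl])
  then show ?thesis
    unfolding matrix_exp_def matrix_power_def by (rule summable_sums)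
qed

lemma isCont_matrix_exp: "isCont matrix_exp (A :: complex^'n^'n)"
proof -
  let ?S = "cball (0 :: complex^'n^'n) (norm A + 1)"
  obtain M where M: "summable M" 
    "\<And>(B :: complex^'n^'n) k. norm B \<le> norm A + 1 \<Longrightarrow> norm ((1 / fact k) *\<^sub>R matrix_power B k) \<le> M k"
    using matrix_exp_uniform_bound[where R="norm A + 1" and 'n='n] by blast
  have "uniform_limit ?S (\<lambda>n B. \<Sum>k<n. (1 / fact k) *\<^sub>R matrix_power B k)
          (\<lambda>B. \<Sum>k. (1 / fact k) *\<^sub>R matrix_power B k) sequentially"
    using M by (intro Weierstrass_m_test) auto
  moreover have "(\<lambda>B. \<Sum>k. (1 / fact k) *\<^sub>R matrix_power B k) = (matrix_exp :: complex^'n^'n \<Rightarrow> _)"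
    by (intro ext sums_unique[OF matrix_exp_sums, symmetric])
  ultimately have "continuous_on ?S matrix_exp"
    by (intro uniform_limit_theorem[where F=sequentially])
       (auto intro!: always_eventually continuous_intros continuous_on_matrix_power)
  then have "continuous_on (ball (0 :: complex^'n^'n) (norm A + 1)) matrix_exp"
    by (rule continuous_on_subset) (rule ball_subset_cball)
  then show ?thesis
    by (simp add: continuous_on_eq_continuous_at)
qed

text \<open>The binomial formula, valid because multiples of the identity commute with
  \<open>A\<close>; dividing by factorials puts it in the shape of a Cauchy product.\<close>

lemma matrix_power_add_scalar:
  fixes A :: "complex^'n^'n"
  shows "(1 / fact k) *\<^sub>R matrix_power (A + s *\<^sub>R mat 1) k =
    (\<Sum>j\<le>k. (s ^ (k - j) / fact (k - j)) *\<^sub>R ((1 / fact j) *\<^sub>R matrix_power A j))"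
proof (induction k)
  case (Suc k)
  define E where "E j = (1 / fact j) *\<^sub>R matrix_power A j" for j
  define w where "w j = s ^ j / fact j" for j
  have AE: "A ** E j = real (Suc j) *\<^sub>R E (Suc j)" for j
    by (simp add: E_def cmatrix_mult.scaleR_right field_simps del: of_nat_Suc)
  have w: "real (Suc j) * w (Suc j) = s * w j" for j
    by (simp add: w_def field_simps del: of_nat_Suc)
  have "real (Suc k) *\<^sub>R ((1 / fact (Suc k)) *\<^sub>R matrix_power (A + s *\<^sub>R mat 1) (Suc k))
      = (A + s *\<^sub>R mat 1) ** ((1 / fact k) *\<^sub>R matrix_power (A + s *\<^sub>R mat 1) k)"
    by (simp add: cmatrix_mult.scaleR_right field_simps del: of_nat_Suc)
  also have "\<dots> = (A + s *\<^sub>R mat 1) ** (\<Sum>j\<le>k. w (k - j) *\<^sub>R E j)"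
    unfolding Suc by (simp add: E_def w_def)
  also have "\<dots> = (\<Sum>j\<le>k. (real (Suc j) * w (k - j)) *\<^sub>R E (Suc j)) + (\<Sum>j\<le>k. (s * w (k - j)) *\<^sub>R E j)"
    unfolding cmatrix_mult.add_left cmatrix_mult.sum_right cmatrix_mult.scaleR_right
        cmatrix_mult.scaleR_left AE matrix_mul_lid scaleR_sum_right scaleR_right_distrib scaleR_scaleR sum.distrib
    by (simp only: mult.commute)
  also have "(\<Sum>j\<le>k. (real (Suc j) * w (k - j)) *\<^sub>R E (Suc j)) =
      (\<Sum>j\<le>Suc k. (real j * w (Suc k - j)) *\<^sub>R E j)"
    by (subst sum.atMost_Suc_shift) simp
  also have "(\<Sum>j\<le>k. (s * w (k - j)) *\<^sub>R E j) = (\<Sum>j\<le>Suc k. (real (Suc k - j) * w (Suc k - j)) *\<^sub>R E j)"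
    by (auto intro!: sum.cong simp: Suc_diff_le w simp del: of_nat_Suc of_nat_diff)
  \<comment> \<open>The weight \<open>Suc k\<close> splits as j + (Suc k - j): the first part comes
    from multiplying by \<open>A\<close>, the second from multiplying by \<open>s\<close>.\<close>
  also have "(\<Sum>j\<le>Suc k. (real j * w (Suc k - j)) *\<^sub>R E j) + \<dots>
      = real (Suc k) *\<^sub>R (\<Sum>j\<le>Suc k. w (Suc k - j) *\<^sub>R E j)"
    unfolding sum.distrib[symmetric] scaleR_sum_right
    by (intro sum.cong) (auto simp: scaleR_left_distrib[symmetric] distrib_right[symmetric] of_nat_diff)
  finally have "real (Suc k) *\<^sub>R ((1 / fact (Suc k)) *\<^sub>R matrix_power (A + s *\<^sub>R mat 1) (Suc k))
      = real (Suc k) *\<^sub>R (\<Sum>j\<le>Suc k. w (Suc k - j) *\<^sub>R E j)" .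
  then show ?case
    unfolding E_def w_def by (simp only: scaleR_cancel_left) simp
qed simp

text \<open>Needed for the shift of the exponent in \<open>reflection_positive\<close>. The two
  exponential series are multiplied entry by entry, as a Cauchy product of absolutely convergent
  complex series.\<close>

lemma matrix_exp_add_scalar:
  fixes A :: "complex^'n^'n"
  shows "matrix_exp (A + s *\<^sub>R mat 1) = exp s *\<^sub>R matrix_exp A"
proof -
  define E where "E j = (1 / fact j) *\<^sub>R matrix_power A j" for j
  define w where "w j = s ^ j / fact j" for j
  obtain M where M: "summable M"
    "\<And>(B :: complex^'n^'n) k. norm B \<le> norm A \<Longrightarrow> norm ((1 / fact k) *\<^sub>R matrix_power B k) \<le> M k"
    using matrix_exp_uniform_bound[where R="norm A" and 'n='n] by blast
  have w: "w sums exp s"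
    using exp_converges[of s] by (simp add: w_def[abs_def] divide_inverse mult.commute)
  have "matrix_exp (A + s *\<^sub>R mat 1) $ a $ b = (exp s *\<^sub>R matrix_exp A) $ a $ b" for a b
  proof -
    have le: "norm (B $ a $ b) \<le> norm B" for B :: "complex^'n^'n"
      using Finite_Cartesian_Product.norm_nth_le[of B a] Finite_Cartesian_Product.norm_nth_le[of "B $ a" b] by simp
    have "summable (\<lambda>j. norm (E j $ a $ b))"
    proof (rule summable_comparison_test'[OF M(1), of 0])
      fix j
      have "norm (E j $ a $ b) \<le> norm (E j)" by (rule le)
      also have "\<dots> \<le> M j" using M(2) by (simp only: E_def)
      finally show "norm (norm (E j $ a $ b)) \<le> M j" by simp
    qed
    moreover have "summable (\<lambda>j. norm (of_real (w j) :: complex))"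
      using summable_norm_exp[of s] by (simp only: norm_of_real) (simp add: w_def divide_inverse abs_mult mult.commute)
    ultimately have "(\<lambda>k. \<Sum>j\<le>k. E j $ a $ b * of_real (w (k - j))) sums
        ((\<Sum>j. E j $ a $ b) * (\<Sum>j. of_real (w j)))"
      by (rule Cauchy_product_sums)
    moreover have "(\<Sum>j. E j $ a $ b) = matrix_exp A $ a $ b"
      using bounded_linear.sums[OF bounded_linear_vec_nth bounded_linear.sums[OF bounded_linear_vec_nth
        matrix_exp_sums[of A]], of a b]
      by (simp add: sums_iff E_def)
    moreover have "(\<Sum>j. of_real (w j)) = (of_real (exp s) :: complex)"
      using sums_unique[OF sums_of_real[OF w, where 'a=complex]] by simp
    moreover have "(\<Sum>j\<le>k. E j $ a $ b * of_real (w (k - j))) = 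
        ((1 / fact k) *\<^sub>R matrix_power (A + s *\<^sub>R mat 1) k) $ a $ b" for k
      unfolding matrix_power_add_scalar by (simp add: E_def w_def scaleR_conv_of_real[where 'a=complex] mult_ac)
    ultimately have "(\<lambda>k. ((1 / fact k) *\<^sub>R matrix_power (A + s *\<^sub>R mat 1) k) $ a $ b) sums
        (matrix_exp A $ a $ b * of_real (exp s))"
      by simp
    moreover have "(\<lambda>k. ((1 / fact k) *\<^sub>R matrix_power (A + s *\<^sub>R mat 1) k) $ a $ b) sums
        (matrix_exp (A + s *\<^sub>R mat 1) $ a $ b)"
      by (intro bounded_linear.sums[OF bounded_linear_vec_nth] matrix_exp_sums)
    ultimately show ?thesis
      by (auto simp: scaleR_conv_of_real[where 'a=complex] dest: sums_unique2)
  qed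
  then show ?thesis by (simp add: vec_eq_iff)
qed

section \<open>Symmetries of Gibbs states\<close>

definition trace_automorphism :: "(complex^'n^'n \<Rightarrow> complex^'n^'n) \<Rightarrow> bool" where
  "trace_automorphism \<Phi> \<longleftrightarrow> linear \<Phi> \<and> \<Phi> (mat 1) = mat 1 \<and>
     (\<forall>A B. \<Phi> (A ** B) = \<Phi> A ** \<Phi> B) \<and> (\<forall>A. trace (\<Phi> A) = trace A)"

lemma trace_automorphism_matrix_exp:
  assumes "trace_automorphism \<Phi>"
  shows "\<Phi> (matrix_exp A) = matrix_exp (\<Phi> A)"
proof -
  from assms have bl: "bounded_linear \<Phi>" and lin: "linear \<Phi>"
    by (auto simp: trace_automorphism_def linear_conv_bounded_linear)
  have "\<Phi> (matrix_power A k) = matrix_power (\<Phi> A) k" for k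
    by (induction k) (use assms in \<open>auto simp: trace_automorphism_def\<close>)
  then have "(\<lambda>k. (1 / fact k) *\<^sub>R matrix_power (\<Phi> A) k) sums \<Phi> (matrix_exp A)"
    using bounded_linear.sums[OF bl matrix_exp_sums[of A]] by (simp add: linear_scale[OF lin])
  then show ?thesis using matrix_exp_sums sums_unique2 by blast
qed

lemma gibbs_state_trace_automorphism:
  assumes \<Phi>: "trace_automorphism \<Phi>"
  shows "gibbs_state \<beta> (\<Phi> H) (\<Phi> A) = gibbs_state \<beta> H A"
proof -
  from \<Phi> have lin: "linear \<Phi>" and mult: "\<And>A B. \<Phi> A ** \<Phi> B = \<Phi> (A ** B)"
    and tr: "\<And>A. trace (\<Phi> A) = trace A"
    by (auto simp: trace_automorphism_def)
  have "matrix_exp ((- \<beta>) *\<^sub>R \<Phi> H) = \<Phi> (matrix_exp ((- \<beta>) *\<^sub>R H))"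
    using trace_automorphism_matrix_exp[OF \<Phi>, of "(- \<beta>) *\<^sub>R H"] by (simp only: linear_scale[OF lin])
  then show ?thesis
    by (simp only: gibbs_state_def partition_function_def mult tr)
qed

lemma linear_gibbs_state: "linear (gibbs_state \<beta> H)"
proof (rule linearI)
  show "gibbs_state \<beta> H (r *\<^sub>R A) = r *\<^sub>R gibbs_state \<beta> H A" for r A
    unfolding gibbs_state_def cmatrix_mult.scaleR_left linear_scale[OF linear_trace]
    by (simp add: scaleR_conv_of_real[where 'a=complex])
qed (simp add: gibbs_state_def cmatrix_mult.add_left trace_add add_divide_distrib)

section \<open>A real basis for the spin operators\<close>

definition real_entries :: "complex^'n^'n \<Rightarrow> bool" where
  "real_entries A \<longleftrightarrow> (\<forall>a b. A $ a $ b \<in> \<real>)"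

lemma mat_mult_nth [simp]: "(mat c ** A) $ a $ b = c * A $ a $ b" for A :: "complex^'n^'n"
  by (simp add: mat_def matrix_matrix_mult_def mult_delta_left)

lemma mult_mat_nth [simp]: "(A ** mat c) $ a $ b = c * A $ a $ b" for A :: "complex^'n^'n"
  by (simp add: mat_def matrix_matrix_mult_def mult_delta_right)

lemma matrix_mult_mat: "A ** (mat c ** B) = mat c ** (A ** B)" for A B :: "complex^'n^'n"
proof -
  have "A ** mat c = mat c ** A" by (simp add: vec_eq_iff)
  then show ?thesis by (simp add: matrix_mul_assoc)
qed

lemma mat_mult_vector: "(mat c ** A) *v x = c *s (A *v x)" for A :: "complex^'n^'n"
  by (simp add: vec_eq_iff matrix_vector_mult_def sum_distrib_left mult.assoc)

lemma norm_smult_vec: "norm (c *s x) = norm c * norm x" for x :: "complex^'n"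
  by (simp add: norm_vec_def norm_mult L2_set_right_distrib)

text \<open>Used to stop the lowering of a weight vector, whose eigenvalues would otherwise tend to
  minus infinity.\<close>

lemma eigenvalues_bounded:
  fixes A :: "complex^'n^'n"
  shows "\<exists>K. \<forall>c x. A *v x = c *s x \<longrightarrow> x \<noteq> 0 \<longrightarrow> norm c \<le> K"
proof -
  obtain K where K: "\<And>x. norm (A *v x) \<le> K * norm x"
    using linear_bounded[OF matrix_vector_mul_linear] by blast
  have "norm c \<le> K" if "A *v x = c *s x" "x \<noteq> 0" for c x
    using K[of x] that by (simp add: norm_smult_vec)
  then show ?thesis by blast
qed

text \<open>\<open>[H, X] = X\<close> with \<open>X\<close> invertible would give \<open>tr 1 = tr (X\<^sup>-\<^sup>1 H X) - tr H = 0\<close>.\<close>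

lemma ladder_operator_kernel:
  fixes H X :: "complex^'n^'n"
  assumes "H ** X = X ** H + X"
  obtains w where "w \<noteq> 0" "X *v w = 0"
proof -
  have "\<not> (\<exists>B. B ** X = mat 1)"
  proof
    assume "\<exists>B. B ** X = mat 1"
    then obtain B where B: "B ** X = mat 1" by blast
    have "trace (B ** (H ** X)) = trace (H ** X ** B)"
      by (subst trace_mul_sym) simp
    also have "\<dots> = trace H"
      using B by (simp add: matrix_mul_assoc[symmetric] matrix_left_right_inverse[of B X])
    finally have "trace (B ** (H ** X)) = trace H" .
    moreover have "B ** (H ** X) = H + mat 1"
      by (simp add: assms cmatrix_mult.add_right matrix_mul_assoc B)
    ultimately have "trace (mat 1 :: complex^'n^'n) = 0"
      by (simp add: trace_add)
    then show False by (simp add: trace_def mat_def)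
  qed
  then show thesis
    using that by (auto simp: matrix_left_invertible_ker)
qed

text \<open>The vectors arise by lowering a highest weight vector without normalisation, so lowering
  has coefficient 1 and raising has real coefficients. The chain has exactly as many non-zero
  vectors as the space has dimensions.\<close>

lemma spin_operators_ladder:
  fixes S1 S2 S3 :: "'s::finite cmatrix"
  assumes spin: "spin_operators S S1 S2 S3" and S: "0 < S" "real CARD('s) = 2 * S + 1"
  obtains v :: "nat \<Rightarrow> complex^'s" and a b :: "nat \<Rightarrow> real"
  where "\<And>k. v k = 0 \<longleftrightarrow> CARD('s) \<le> k"
    "\<And>k. (S1 - mat \<i> ** S2) *v v k = v (Suc k)"
    "\<And>k. S3 *v v k = complex_of_real (a k) *s v k"
    "(S1 + mat \<i> ** S2) *v v 0 = 0"
    "\<And>k. (S1 + mat \<i> ** S2) *v v (Suc k) = complex_of_real (b k) *s v k"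
proof -
  define J where "J A = mat \<i> ** A" for A :: "'s cmatrix"
  define Sp where "Sp = S1 + J S2"
  define Sm where "Sm = S1 - J S2"
  have c12: "S1 ** S2 = S2 ** S1 + J S3"
    and c23: "S2 ** S3 = S3 ** S2 + J S1"
    and c31: "S3 ** S1 = S1 ** S3 + J S2"
    and casimir: "S1 ** S1 + S2 ** S2 + S3 ** S3 = mat (complex_of_real (S * (S + 1)))"
    using spin by (auto simp: spin_operators_def commutator_def J_def algebra_simps)
  have J: "J (A + B) = J A + J B" "J (A - B) = J A - J B" "J (- A) = - J A" "J (J A) = - A" for A B
    by (simp_all add: J_def vec_eq_iff algebra_simps)
  have J_mult: "J A ** B = J (A ** B)" "A ** J B = J (A ** B)" for A B
    unfolding J_def by (rule matrix_mul_assoc[symmetric], rule matrix_mult_mat)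
  \<comment> \<open>Rewriting with the commutation relations brings every quadratic product to one
    of the orders \<open>S2 ** S1\<close>, \<open>S3 ** S2\<close>, \<open>S1 ** S3\<close>; the
    ladder identities then reduce to linear cancellation.\<close>
  note expand = cmatrix_mult.add_left cmatrix_mult.add_right cmatrix_mult.diff_left
    cmatrix_mult.diff_right J J_mult c12 c23 c31
  have h_p: "S3 ** Sp = Sp ** S3 + Sp" and h_m: "S3 ** Sm = Sm ** S3 - Sm"
    by (simp_all add: Sp_def Sm_def expand)
  have p_m: "Sp ** Sm = Sm ** Sp + (S3 + S3)"
    by (simp add: Sp_def Sm_def expand)
  have p_m': "Sp *v (Sm *v x) = Sm *v (Sp *v x) + (S3 *v x + S3 *v x)" for x
    using arg_cong[OF p_m, of "\<lambda>A. A *v x"]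
    by (simp only: matrix_vector_mult_add_rdistrib matrix_vector_mul_assoc[symmetric])
  have m_p: "Sm ** Sp + S3 ** S3 + S3 = mat (complex_of_real (S * (S + 1)))"
    unfolding casimir[symmetric] by (simp add: Sp_def Sm_def expand)
  obtain w0 where w0: "w0 \<noteq> 0" "Sp *v w0 = 0"
    using ladder_operator_kernel[OF h_p] by blast
  have "(Sm ** Sp + S3 ** S3 + S3) *v w0 = complex_of_real (S * (S + 1)) *s w0"
    unfolding m_p using mat_mult_vector[of _ "mat 1" w0] by simp
  then have S3S3: "S3 *v (S3 *v w0) + S3 *v w0 = complex_of_real (S * (S + 1)) *s w0"
    using w0 by (simp add: matrix_vector_mult_add_rdistrib matrix_vector_mul_assoc[symmetric])
  \<comment> \<open>On the kernel of \<open>Sp\<close> the Casimir relation reads (S3 - S) (S3 + S +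
    1) w0 = 0. Either the second factor kills \<open>w0\<close>, or it maps \<open>w0\<close> to an
    eigenvector for S that is still annihilated by \<open>Sp\<close>.\<close>
  have "\<exists>w m. w \<noteq> 0 \<and> Sp *v w = 0 \<and> S3 *v w = complex_of_real m *s w \<and> (m = S \<or> m = - S - 1)"
  proof (cases "S3 *v w0 + complex_of_real (S + 1) *s w0 = 0")
    case True
    then have "S3 *v w0 = - (complex_of_real (S + 1) *s w0)"
      by (simp only: eq_neg_iff_add_eq_0)
    also have "\<dots> = complex_of_real (- S - 1) *s w0"
      by (simp add: vec_eq_iff algebra_simps)
    finally have "S3 *v w0 = complex_of_real (- S - 1) *s w0" .
    then show ?thesis using w0 by blast
  next
    case False
    define w where "w = S3 *v w0 + complex_of_real (S + 1) *s w0"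
    have "Sp *v (S3 *v w0) = 0"
      using arg_cong[OF h_p, of "\<lambda>A. A *v w0"] w0
      by (simp add: matrix_vector_mult_add_rdistrib matrix_vector_mul_assoc[symmetric])
    then have "Sp *v w = 0"
      using w0 by (simp add: w_def matrix_vector_right_distrib vector_scalar_commute)
    moreover have "S3 *v (S3 *v w0) = complex_of_real (S * (S + 1)) *s w0 - S3 *v w0"
      using S3S3 by (simp add: eq_diff_eq)
    then have "S3 *v w = complex_of_real S *s w"
      by (simp add: w_def matrix_vector_right_distrib vector_scalar_commute)
        (simp add: vec_eq_iff algebra_simps)
    ultimately show ?thesis using False w_def by blast
  qed
  then obtain w m where w: "w \<noteq> 0" "Sp *v w = 0" "S3 *v w = complex_of_real m *s w"
    and m: "m = S \<or> m = - S - 1" by blast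
  define v where "v k = ((*v) Sm ^^ k) w" for k
  have v0: "v 0 = w" and vS: "v (Suc k) = Sm *v v k" for k by (simp_all add: v_def)
  have ev: "S3 *v v k = complex_of_real (m - k) *s v k" for k
  proof (induction k)
    case (Suc k)
    have "S3 *v v (Suc k) = Sm *v (S3 *v v k) - Sm *v v k"
      using arg_cong[OF h_m, of "\<lambda>A. A *v v k"]
      by (simp add: vS matrix_vector_mult_diff_rdistrib matrix_vector_mul_assoc)
    then show ?case
      unfolding Suc vector_scalar_commute vS by (simp add: vec_eq_iff algebra_simps)
  qed (use w in \<open>simp add: v0\<close>)
  \<comment> \<open>Moving \<open>Sp\<close> past one \<open>Sm\<close> adds twice the current
    eigenvalue, and the sum of 2 (m - j) over j = 0, ..., k is (k + 1) (2 m - k).\<close>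
  have raise: "Sp *v v (Suc k) = complex_of_real (real (Suc k) * (2 * m - k)) *s v k" for k
  proof (induction k)
    case 0
    show ?case
      unfolding vS v0 p_m' w by (simp add: vec_eq_iff algebra_simps)
  next
    case (Suc k)
    have "Sp *v v (Suc (Suc k)) = Sm *v (Sp *v v (Suc k)) + (S3 *v v (Suc k) + S3 *v v (Suc k))"
      unfolding vS[of "Suc k"] by (rule p_m')
    then show ?case
      unfolding Suc ev vector_scalar_commute vS[symmetric]
      by (simp add: vec_eq_iff algebra_simps)
  qed
  have "\<exists>n. v n = 0"
  proof (rule ccontr)
    assume *: "\<not> ?thesis"
    obtain K where "\<And>c x. S3 *v x = c *s x \<Longrightarrow> x \<noteq> 0 \<Longrightarrow> norm c \<le> K"
      using eigenvalues_bounded by blast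
    with ev * have K: "norm (complex_of_real (m - k)) \<le> K" for k :: nat by blast
    obtain k :: nat where "K + \<bar>m\<bar> < k" using reals_Archimedean2 by blast
    with K[of k] show False by (simp only: norm_of_real)
  qed
  define N where "N = (LEAST n. v n = 0)"
  have vN: "v N = 0" and v_nz: "\<And>k. k < N \<Longrightarrow> v k \<noteq> 0"
    using \<open>\<exists>n. v n = 0\<close> not_less_Least unfolding N_def by (auto intro: LeastI)
  have "N \<noteq> 0" using vN w v0 by (intro notI) simp
  then obtain n where n: "N = Suc n" by (cases N) auto
  \<comment> \<open>Raising \<open>v N\<close>, which is zero, must give zero, while the last vector
    \<open>v n\<close> is not zero; hence 2 m = n. As n is non-negative, this excludes m = - S - 1
    and makes the length n + 1 equal to 2 S + 1.\<close>
  have "complex_of_real (real (Suc n) * (2 * m - n)) *s v n = 0"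
    using raise[of n] vN by (simp only: n matrix_vector_mult_0_right)
  then have "2 * m = n"
    using v_nz[of n] by (simp only: vector_mul_eq_0 of_real_eq_0_iff mult_eq_0_iff n) auto
  with m S n have N: "N = CARD('s)" by auto
  have "v k = 0" if "k \<ge> N" for k
    using that by (induction rule: dec_induct) (auto simp: vN vS)
  with v_nz have "v k = 0 \<longleftrightarrow> CARD('s) \<le> k" for k
    unfolding N[symmetric] by (meson not_le)
  moreover have "Sp *v v 0 = 0" using w v0 by simp
  ultimately show thesis
    using that[of v "\<lambda>k. m - k" "\<lambda>k. real (Suc k) * (2 * m - k)"] vS[symmetric] ev raise
    unfolding Sp_def Sm_def J_def by blast
qed

text \<open>The columns of \<open>P\<close> are the ladder vectors. Lowering, raising and
  \<open>S3\<close> are real in this basis, hence so are \<open>S1\<close> and i \<open>S2\<close>,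
  being half the sum and half the difference of raising and lowering. Without normalisation
  \<open>P\<close> need not be unitary, but conjugation by it still preserves products and
  traces.\<close>

lemma spin_operators_real_basis:
  fixes S1 S2 S3 :: "'s::finite cmatrix"
  assumes spin: "spin_operators S S1 S2 S3" and S: "0 < S" "real CARD('s) = 2 * S + 1"
  obtains P P' :: "'s cmatrix" where "P ** P' = mat 1" "P' ** P = mat 1"
    "real_entries (P' ** S1 ** P)" "real_entries (mat \<i> ** (P' ** S2 ** P))" "real_entries (P' ** S3 ** P)"
proof -
  define Sp where "Sp = S1 + mat \<i> ** S2"
  define Sm where "Sm = S1 - mat \<i> ** S2"
  obtain v a b where v0: "\<And>k. v k = 0 \<longleftrightarrow> CARD('s) \<le> k"
    and vS: "\<And>k. Sm *v v k = v (Suc k)"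
    and ev: "\<And>k. S3 *v v k = complex_of_real (a k) *s v k"
    and top: "Sp *v v 0 = 0"
    and raise: "\<And>k. Sp *v v (Suc k) = complex_of_real (b k) *s v k"
    unfolding Sp_def Sm_def by (rule spin_operators_ladder[OF assms]) blast
  define n where "n = CARD('s) - 1"
  have n: "CARD('s) = Suc n" by (simp add: n_def)
  obtain idx :: "'s \<Rightarrow> nat" where idx: "bij_betw idx UNIV {0..<Suc n}"
    using ex_bij_betw_finite_nat[of "UNIV :: 's set"] n by auto
  define P :: "'s cmatrix" where "P = (\<chi> r s. v (idx s) $ r)"
  have P_eq: "P *v x = (\<Sum>s\<in>UNIV. x $ s *s v (idx s))" for x
    by (simp add: P_def matrix_vector_mult_def vec_eq_iff mult.commute)
  \<comment> \<open>Linear independence: take the least index with non-zero coefficient in a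
    vanishing combination and lower until this term reaches the bottom vector \<open>v n\<close>;
    all others have then become zero.\<close>
  have "x = 0" if Px: "P *v x = 0" for x
  proof (rule ccontr)
    assume "x \<noteq> 0"
    then have "\<exists>s. x $ s \<noteq> 0" by (simp add: vec_eq_iff)
    then obtain s0 where s0: "x $ s0 \<noteq> 0" and min: "\<And>s. x $ s \<noteq> 0 \<Longrightarrow> idx s0 \<le> idx s"
      using ex_has_least_nat[of "\<lambda>s. x $ s \<noteq> 0" _ idx] by blast
    have "(\<Sum>s\<in>UNIV. x $ s *s v (idx s + j)) = 0" for j
    proof (induction j)
      case 0
      show ?case using Px P_eq by simp
    next
      case (Suc j)
      have "Sm *v (\<Sum>s\<in>UNIV. x $ s *s v (idx s + j)) = (\<Sum>s\<in>UNIV. x $ s *s v (idx s + Suc j))"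
        by (simp add: vS vec.linear_sum[OF matrix_vector_mul_linear_gen] vector_scalar_commute)
      then show ?case using Suc by simp
    qed
    from this[of "n - idx s0"]
    have "(\<Sum>s\<in>UNIV. x $ s *s v (idx s + (n - idx s0))) = 0" .
    also have "(\<Sum>s\<in>UNIV. x $ s *s v (idx s + (n - idx s0))) = (\<Sum>s\<in>{s0}. x $ s *s v (idx s + (n - idx s0)))"
    proof (rule sum.mono_neutral_right)
      show "\<forall>s\<in>UNIV - {s0}. x $ s *s v (idx s + (n - idx s0)) = 0"
      proof
        fix s assume "s \<in> UNIV - {s0}"
        then have "idx s \<noteq> idx s0" using idx by (auto simp: bij_betw_def inj_on_def)
        then have "x $ s = 0 \<or> idx s > idx s0" using min[of s] by (cases "x $ s = 0") auto
        then show "x $ s *s v (idx s + (n - idx s0)) = 0"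
          using v0[of "idx s + (n - idx s0)"] by (auto simp: n)
      qed
    qed auto
    also have "\<dots> = x $ s0 *s v n"
    proof -
      have "idx s0 \<in> {0..<Suc n}" using idx by (auto simp: bij_betw_def)
      then show ?thesis by (simp add: n)
    qed
    finally show False using s0 v0[of n] by (simp add: n vector_mul_eq_0)
  qed
  then obtain P' where P'P: "P' ** P = mat 1"
    using matrix_left_invertible_ker[of P] by blast
  have PP': "P ** P' = mat 1" using P'P matrix_left_right_inverse by blast
  \<comment> \<open>\<open>R\<close> is the real span of the ladder vectors. An operator sending
    each of them into \<open>R\<close> has real matrix entries in the basis
    \<open>P\<close>.\<close>
  define R where "R = {P *v y | y. \<forall>t. y $ t \<in> \<real>}"
  have R_v: "complex_of_real c *s v k \<in> R" for c k
  proof (cases "k < Suc n")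
    case True
    then have "k \<in> range idx" using idx by (simp add: bij_betw_def)
    then obtain t where t: "idx t = k" by auto
    have "complex_of_real c *s v k = P *v (\<chi> s. if s = t then complex_of_real c else 0)"
      unfolding P_eq by (simp add: t if_distrib[of "\<lambda>c. c *s _"] cong: if_cong)
    then show ?thesis unfolding R_def by (auto intro!: exI)
  next
    case False
    then have "complex_of_real c *s v k = P *v 0" by (simp add: v0 n)
    moreover have "P *v 0 \<in> R" unfolding R_def by (intro CollectI exI[of _ 0]) simp
    ultimately show ?thesis by (simp only:)
  qed
  have real: "real_entries (P' ** A ** P)" if A: "\<And>k. A *v v k \<in> R" for A
    unfolding real_entries_def
  proof (intro allI)
    fix a b
    have "P *v axis b 1 = v (idx b)"
      unfolding P_eq by (simp add: axis_def if_distrib[of "\<lambda>c. c *s _"] cong: if_cong)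
    moreover obtain y where y: "A *v v (idx b) = P *v y" "\<And>t. y $ t \<in> \<real>"
      using A[of "idx b"] unfolding R_def by blast
    ultimately have "(P' ** A ** P) *v axis b 1 = y"
      using P'P by (simp add: matrix_vector_mul_assoc[symmetric])
        (simp add: matrix_vector_mul_assoc)
    moreover have "((P' ** A ** P) *v axis b 1) $ a = (P' ** A ** P) $ a $ b"
      by (simp add: matrix_vector_mult_def axis_def if_distrib cong: if_cong)
    ultimately show "(P' ** A ** P) $ a $ b \<in> \<real>" using y(2) by metis
  qed
  have r3: "real_entries (P' ** S3 ** P)"
    by (rule real) (simp only: ev R_v)
  have rm: "real_entries (P' ** Sm ** P)"
    by (rule real) (use R_v[of 1] in \<open>simp add: vS\<close>)
  have rp: "real_entries (P' ** Sp ** P)"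
  proof (rule real)
    show "Sp *v v k \<in> R" for k
    proof (cases k)
      case 0
      then show ?thesis using R_v[of 0 0] top by simp
    next
      case (Suc j)
      then show ?thesis by (simp only: raise R_v)
    qed
  qed
  have "S1 = (1/2) *\<^sub>R (Sp + Sm)" "mat \<i> ** S2 = (1/2) *\<^sub>R (Sp - Sm)"
    by (simp_all add: Sp_def Sm_def vec_eq_iff)
  then have "P' ** S1 ** P = (1/2) *\<^sub>R (P' ** Sp ** P + P' ** Sm ** P)"
    and "P' ** (mat \<i> ** S2) ** P = (1/2) *\<^sub>R (P' ** Sp ** P - P' ** Sm ** P)"
    by (simp_all add: cmatrix_mult.scaleR_left cmatrix_mult.scaleR_right cmatrix_mult.add_left 
        cmatrix_mult.add_right cmatrix_mult.diff_left cmatrix_mult.diff_right)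
  moreover have "mat \<i> ** (P' ** S2 ** P) = P' ** (mat \<i> ** S2) ** P"
    by (simp only: matrix_mult_mat) (simp only: matrix_mul_assoc)
  ultimately have "real_entries (P' ** S1 ** P)" "real_entries (mat \<i> ** (P' ** S2 ** P))"
    using rp rm by (simp_all add: real_entries_def scaleR_conv_of_real[where 'a=complex])
  with PP' P'P show thesis using r3 by (intro that)
qed

section \<open>Tensor products and relabellings\<close>

text \<open>Pure tensors multiply site by site, so the same change of basis at every site is
  conjugation by one of them.\<close>

definition tensor :: "('v::finite \<Rightarrow> 's::finite cmatrix) \<Rightarrow> ('v \<Rightarrow> 's) cmatrix" where
  "tensor F = (\<chi> \<sigma> \<tau>. \<Prod>x\<in>UNIV. F x $ \<sigma> x $ \<tau> x)"

lemma tensor_mult: "tensor F ** tensor G = tensor (\<lambda>x. F x ** G x)"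
proof -
  have "(tensor F ** tensor G) $ \<sigma> $ \<tau> = tensor (\<lambda>x. F x ** G x) $ \<sigma> $ \<tau>" for \<sigma> \<tau>
    by (simp add: tensor_def matrix_matrix_mult_def prod_sum_PiE PiE_UNIV_domain prod.distrib)
  then show ?thesis by (simp add: vec_eq_iff)
qed

lemma tensor_mat_1: "tensor (\<lambda>_. mat 1) = mat 1"
proof -
  have "(\<Prod>x\<in>UNIV. if \<sigma> x = \<tau> x then 1 else 0 :: complex) = (if \<sigma> = \<tau> then 1 else 0)"
    for \<sigma> \<tau> :: "'a \<Rightarrow> 'b"
  proof (cases "\<sigma> = \<tau>")
    case False
    then obtain x where "\<sigma> x \<noteq> \<tau> x" by auto
    then have "(\<Prod>x\<in>UNIV. if \<sigma> x = \<tau> x then 1 else 0 :: complex) = 0"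
      by (intro prod_zero) auto
    then show ?thesis using False by simp
  qed simp
  then show ?thesis by (simp add: tensor_def mat_def vec_eq_iff)
qed

lemma site_op_tensor: "site_op A x = tensor (\<lambda>y. if y = x then A else mat 1)"
proof -
  have "(\<Prod>y\<in>UNIV. (if y = x then A else mat 1) $ \<sigma> y $ \<tau> y)
      = A $ \<sigma> x $ \<tau> x * (\<Prod>y\<in>UNIV - {x}. (if y = x then A else mat 1) $ \<sigma> y $ \<tau> y)" for \<sigma> \<tau>
    by (subst prod.remove[of _ x]) auto
  moreover have "(\<Prod>y\<in>UNIV - {x}. (if y = x then A else mat 1) $ \<sigma> y $ \<tau> y)
      = (\<Prod>y\<in>UNIV - {x}. if \<sigma> y = \<tau> y then 1 else 0)" for \<sigma> \<tau>
    by (intro prod.cong) (auto simp: mat_def)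
  ultimately show ?thesis by (simp add: site_op_def tensor_def vec_eq_iff)
qed

lemma site_op_conjugate:
  assumes "P' ** P = mat 1"
  shows "tensor (\<lambda>_. P') ** site_op A x ** tensor (\<lambda>_. P) = site_op (P' ** A ** P) x"
proof -
  have "(\<lambda>y. P' ** (if y = x then A else mat 1) ** P) = (\<lambda>y. if y = x then P' ** A ** P else mat 1)"
    using assms by auto
  then show ?thesis by (simp add: site_op_tensor tensor_mult)
qed

lemma site_op_mat_mult: "site_op (mat c ** A) x = mat c ** site_op A x"
  by (auto simp: vec_eq_iff site_op_nth)

lemma trace_automorphism_conjugate:
  assumes "Q' ** Q = mat 1" "Q ** Q' = mat 1"
  shows "trace_automorphism (\<lambda>M :: complex^'n^'n. Q' ** M ** Q)"
  unfolding trace_automorphism_def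
proof (intro conjI allI)
  show "linear (\<lambda>M. Q' ** M ** Q)"
    by (intro linearI) (simp_all only: cmatrix_mult.add_left cmatrix_mult.add_right
      cmatrix_mult.scaleR_left cmatrix_mult.scaleR_right)
  show "Q' ** mat 1 ** Q = mat 1" using assms by simp
  show "Q' ** (A ** B) ** Q = Q' ** A ** Q ** (Q' ** B ** Q)" for A B
    using assms(2) by (metis matrix_mul_assoc matrix_mul_rid)
  show "trace (Q' ** A ** Q) = trace A" for A
    by (subst trace_mul_sym) (simp add: matrix_mul_assoc assms)
qed

text \<open>Composing configurations with \<open>p\<close>, and not with its inverse, moves an
  operator at x to \<open>p\<close> x.\<close>

definition relabel :: "('v \<Rightarrow> 'v) \<Rightarrow> ('v::finite \<Rightarrow> 's::finite) cmatrix \<Rightarrow> ('v \<Rightarrow> 's) cmatrix" where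
  "relabel p M = (\<chi> \<sigma> \<tau>. M $ (\<sigma> \<circ> p) $ (\<tau> \<circ> p))"

lemma trace_automorphism_relabel:
  fixes p :: "'v::finite \<Rightarrow> 'v"
  assumes "bij p"
  shows "trace_automorphism (relabel p :: ('v \<Rightarrow> 's::finite) cmatrix \<Rightarrow> _)"
proof -
  define q where "q = inv_into UNIV p"
  have "q (p x) = x" "p (q x) = x" for x
    using assms unfolding q_def by (auto simp: bij_is_inj bij_is_surj f_inv_into_f)
  then have bij: "bij (\<lambda>\<sigma> :: 'v \<Rightarrow> 's. \<sigma> \<circ> p)"
    by (intro o_bij[of "\<lambda>\<sigma>. \<sigma> \<circ> q"]) (auto simp: fun_eq_iff)
  have sum: "(\<Sum>\<sigma>\<in>UNIV. f (\<sigma> \<circ> p)) = (\<Sum>\<sigma>\<in>UNIV. f \<sigma>)" for f :: "('v \<Rightarrow> 's) \<Rightarrow> complex"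
    using sum.reindex_bij_betw[OF bij, of f] .
  have inj: "\<sigma> \<circ> p = \<tau> \<circ> p \<longleftrightarrow> \<sigma> = \<tau>" for \<sigma> \<tau> :: "_ \<Rightarrow> 's"
    using bij by (auto dest: bij_is_inj injD)
  show ?thesis
    unfolding trace_automorphism_def
  proof (intro conjI allI)
    show "linear (relabel p :: ('v \<Rightarrow> 's) cmatrix \<Rightarrow> _)"
      by (rule linearI) (simp_all add: relabel_def vec_eq_iff)
    show "relabel p (mat 1 :: ('v \<Rightarrow> 's) cmatrix) = mat 1"
      by (simp add: relabel_def mat_def inj vec_eq_iff)
    show "relabel p (A ** B) = relabel p A ** relabel p B" for A B :: "('v \<Rightarrow> 's) cmatrix"
      using sum[of "\<lambda>\<rho>. A $ _ $ \<rho> * B $ \<rho> $ _"]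
      by (simp add: relabel_def matrix_matrix_mult_def vec_eq_iff)
    show "trace (relabel p A) = trace A" for A :: "('v \<Rightarrow> 's) cmatrix"
      using sum[of "\<lambda>\<rho>. A $ \<rho> $ \<rho>"] by (simp add: relabel_def trace_def)
  qed
qed

lemma relabel_site_op:
  fixes A :: "'s::finite cmatrix"
  assumes "bij p"
  shows "relabel p (site_op A x) = site_op A (p x)"
proof -
  have "(\<forall>y. y \<noteq> x \<longrightarrow> \<sigma> (p y) = \<tau> (p y)) \<longleftrightarrow> (\<forall>y. y \<noteq> p x \<longrightarrow> \<sigma> y = \<tau> y)" for \<sigma> \<tau> :: "_ \<Rightarrow> 's"
    using assms by (metis bij_pointE)
  then show ?thesis
    by (simp only: relabel_def vec_eq_iff vec_lambda_beta site_op_nth o_apply) simp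
qed

lemma edge_exchange_map:
  assumes lin: "linear \<Phi>" and mult: "\<And>A B. \<Phi> (A ** B) = \<Phi> A ** \<Phi> B"
    and site: "\<And>x. \<Phi> (site_op S1 x) = site_op S1' (p x)" "\<And>x. \<Phi> (site_op S2 x) = site_op S2' (p x)"
      "\<And>x. \<Phi> (site_op S3 x) = site_op S3' (p x)"
    and p: "inj p"
  shows "\<Phi> (edge_exchange S1 S2 S3 u e) = edge_exchange S1' S2' S3' u (p ` e)"
proof -
  have exch: "\<Phi> (exchange S1 S2 S3 u x y) = exchange S1' S2' S3' u (p x) (p y)" for x y
    by (simp add: exchange_def linear_add[OF lin] linear_scale[OF lin] mult site)
  have "(\<Sum>y\<in>p ` e - {p x}. exchange S1' S2' S3' u (p x) y) =
      (\<Sum>y\<in>e - {x}. exchange S1' S2' S3' u (p x) (p y))" for x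
  proof -
    have "p ` e - {p x} = p ` (e - {x})" using p by (auto simp: inj_def)
    then show ?thesis using p by (simp add: sum.reindex inj_on_subset o_def)
  qed
  then show ?thesis
    using p by (simp add: edge_exchange_def linear_scale[OF lin] linear_sum[OF lin] exch
        sum.reindex inj_on_subset)
qed

lemma sum_edge_image:
  assumes "inj p" "\<And>e. e \<in> E \<Longrightarrow> p ` e \<in> E" "finite E"
  shows "(\<Sum>e\<in>E. f (p ` e)) = (\<Sum>e\<in>E. f e)"
proof -
  have inj: "inj_on ((`) p) E" using assms(1) by (intro inj_onI) (simp add: inj_image_eq_iff)
  then have "(`) p ` E = E" using assms by (intro endo_inj_surj) auto
  then show ?thesis using sum.reindex[OF inj, of f] by simp
qed

text \<open>Serves two kinds of symmetry: a change of basis, with \<open>p\<close> the identity and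
  new spin matrices, and a symmetry \<open>p\<close> of the torus, with unchanged spin
  matrices.\<close>

lemma gibbs_hamiltonian_map:
  fixes \<Phi> :: "(('l::nontriv mod_ring ^ 'd::finite) \<Rightarrow> 's::finite) cmatrix \<Rightarrow> _"
  assumes \<Phi>: "trace_automorphism \<Phi>"
    and site: "\<And>x. \<Phi> (site_op S1 x) = site_op S1' (p x)" "\<And>x. \<Phi> (site_op S2 x) = site_op S2' (p x)"
      "\<And>x. \<Phi> (site_op S3 x) = site_op S3' (p x)"
    and p: "inj p" "\<And>e. e \<in> torus_edges \<Longrightarrow> p ` e \<in> torus_edges"
  shows "gibbs_state \<beta> (hamiltonian S1' S2' S3' u) (site_op S3' (p x) ** site_op S3' (p y)) =
    gibbs_state \<beta> (hamiltonian S1 S2 S3 u) (site_op S3 x ** site_op S3 y)"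
proof -
  from \<Phi> have lin: "linear \<Phi>" and mult: "\<And>A B. \<Phi> (A ** B) = \<Phi> A ** \<Phi> B"
    by (auto simp: trace_automorphism_def)
  have "\<Phi> (hamiltonian S1 S2 S3 u) = hamiltonian S1' S2' S3' u"
    unfolding hamiltonian_def linear_scale[OF lin] linear_sum[OF lin]
      edge_exchange_map[OF lin mult site p(1)]
    using sum_edge_image[OF p, of "edge_exchange S1' S2' S3' u"] by simp
  moreover have "\<Phi> (site_op S3 x ** site_op S3 y) = site_op S3' (p x) ** site_op S3' (p y)"
    by (simp add: mult site)
  ultimately show ?thesis
    using gibbs_state_trace_automorphism[OF \<Phi>] by metis
qed

lemma spin_corr_real_basis:
  fixes S1 S2 S3 :: "'s::finite cmatrix"
  assumes "spin_operators S S1 S2 S3" and "0 < S" "real CARD('s) = 2 * S + 1"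
  obtains T1 T2 T3 :: "'s cmatrix" where
    "real_entries T1" "real_entries (mat \<i> ** T2)" "real_entries T3"
    "spin_corr S1 S2 S3 u \<beta> = (spin_corr T1 T2 T3 u \<beta> :: 'l::nontriv mod_ring ^ 'd::finite \<Rightarrow> complex)"
proof -
  obtain P P' :: "'s cmatrix" where P: "P ** P' = mat 1" "P' ** P = mat 1" and
    real: "real_entries (P' ** S1 ** P)" "real_entries (mat \<i> ** (P' ** S2 ** P))" "real_entries (P' ** S3 ** P)"
    by (rule spin_operators_real_basis[OF assms])
  let ?\<Phi> = "\<lambda>M :: (('l mod_ring ^ 'd) \<Rightarrow> 's) cmatrix. tensor (\<lambda>_. P') ** M ** tensor (\<lambda>_. P)"
  have "trace_automorphism ?\<Phi>"
    by (rule trace_automorphism_conjugate) (simp_all add: tensor_mult P tensor_mat_1)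
  note map = gibbs_hamiltonian_map[where p="\<lambda>x. x", OF this
      site_op_conjugate[OF P(2)] site_op_conjugate[OF P(2)] site_op_conjugate[OF P(2)]]
  have "spin_corr S1 S2 S3 u \<beta> z =
      spin_corr (P' ** S1 ** P) (P' ** S2 ** P) (P' ** S3 ** P) u \<beta> z" for z :: "'l mod_ring ^ 'd"
    unfolding spin_corr_def by (rule map[symmetric]) auto
  with real show thesis by (intro that[of "P' ** S1 ** P" "P' ** S2 ** P" "P' ** S3 ** P"]) (auto simp: matrix_mul_assoc matrix_mult_mat fun_eq_iff)
qed

section \<open>Reflection positivity\<close>

lemma closed_nonneg_complex: "closed {z :: complex. 0 \<le> z}"
  unfolding less_eq_complex_def
  by (intro closed_Collect_conj closed_Collect_le closed_Collect_eq continuous_intros)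

lemma nonneg_complex_LIMSEQ:
  fixes X :: "nat \<Rightarrow> complex"
  assumes "X \<longlonglongrightarrow> l" "\<And>n. 0 \<le> X n"
  shows "0 \<le> l"
  using closed_sequentially[OF closed_nonneg_complex] assms by blast

text \<open>Squaring i turns u into -u. For u <= 0 all three coefficients become non-negative while
  the factors are real in the ladder basis, as \<open>cone_exchange\<close> requires.\<close>

lemma exchange_imaginary:
  "exchange S1 S2 S3 u x y = site_op S1 x ** site_op S1 y
    + (- u) *\<^sub>R (site_op (mat \<i> ** S2) x ** site_op (mat \<i> ** S2) y) + site_op S3 x ** site_op S3 y"
proof -
  have "(mat \<i> ** A) ** (mat \<i> ** B) = - (A ** B)" for A B :: "('a \<Rightarrow> 'b) cmatrix"
  proof -
    have "(mat \<i> ** A) ** (mat \<i> ** B) = mat \<i> ** (mat \<i> ** (A ** B))"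
      by (subst matrix_mult_mat) (simp only: matrix_mul_assoc)
    then show ?thesis by (simp add: vec_eq_iff)
  qed
  then show ?thesis by (simp add: exchange_def site_op_mat_mult)
qed

text \<open>By the second axiom \<open>\<Lambda>\<close> contains exactly one of x and its image. So
  there is no fixed point, as for a plane that cuts edges and meets no site.\<close>

locale reflection =
  fixes \<rho> :: "'v::finite \<Rightarrow> 'v" and \<Lambda> :: "'v set"
  assumes involution [simp]: "\<rho> (\<rho> x) = x"
    and half [simp]: "\<rho> x \<in> \<Lambda> \<longleftrightarrow> x \<notin> \<Lambda>"
begin

lemma inj_reflection: "inj \<rho>"
  by (metis injI involution)

lemma bij_reflection: "bij \<rho>"
  by (rule o_bij[of \<rho>]) (auto simp: fun_eq_iff)

text \<open>Half-configurations are functions on all sites with the value \<open>undefined\<close>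
  off \<open>\<Lambda>\<close>, so that each has a unique representative.\<close>

definition confs :: "('v \<Rightarrow> 's::finite) set" where
  "confs = range (\<lambda>\<sigma>. restrict \<sigma> \<Lambda>)"

lemma restrict_in_confs [simp]: "restrict \<sigma> \<Lambda> \<in> confs"
  by (simp add: confs_def)

text \<open>A configuration amounts to a free choice of two half-configurations, the one on
  \<open>\<Lambda>\<close> and the reflected one of the other half.\<close>

lemma sum_split:
  fixes h :: "('v \<Rightarrow> 's::finite) \<Rightarrow> ('v \<Rightarrow> 's) \<Rightarrow> real"
  shows "(\<Sum>\<sigma>\<in>UNIV. h (restrict \<sigma> \<Lambda>) (restrict (\<sigma> \<circ> \<rho>) \<Lambda>)) = (\<Sum>a\<in>confs. \<Sum>b\<in>confs. h a b)"
proof -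
  have "(\<Sum>\<sigma>\<in>UNIV. h (restrict \<sigma> \<Lambda>) (restrict (\<sigma> \<circ> \<rho>) \<Lambda>)) = (\<Sum>(a, b)\<in>confs \<times> confs. h a b)"
    by (rule sum.reindex_bij_witness[of _ "\<lambda>(a, b) x. if x \<in> \<Lambda> then a x else b (\<rho> x)"
        "\<lambda>\<sigma>. (restrict \<sigma> \<Lambda>, restrict (\<sigma> \<circ> \<rho>) \<Lambda>)"])
       (auto simp: confs_def fun_eq_iff)
  then show ?thesis by (simp add: sum.cartesian_product)
qed

text \<open>\<open>kern f g\<close> is the operator \<open>f \<otimes> g\<close> on (left half) \<open>\<otimes>\<close> (right half), both halves being
  described by configurations on \<open>\<Lambda>\<close>: the right one is pulled back along \<open>\<rho>\<close>.\<close>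

definition kern :: "(('v \<Rightarrow> 's) \<Rightarrow> ('v \<Rightarrow> 's) \<Rightarrow> real) \<Rightarrow> (('v \<Rightarrow> 's) \<Rightarrow> ('v \<Rightarrow> 's) \<Rightarrow> real) \<Rightarrow>
    ('v \<Rightarrow> 's::finite) cmatrix" where
  "kern f g = (\<chi> \<sigma> \<tau>. complex_of_real (f (restrict \<sigma> \<Lambda>) (restrict \<tau> \<Lambda>) *
     g (restrict (\<sigma> \<circ> \<rho>) \<Lambda>) (restrict (\<tau> \<circ> \<rho>) \<Lambda>)))"

definition comp_kern :: "(('v \<Rightarrow> 's) \<Rightarrow> ('v \<Rightarrow> 's) \<Rightarrow> real) \<Rightarrow> (('v \<Rightarrow> 's) \<Rightarrow> ('v \<Rightarrow> 's) \<Rightarrow> real) \<Rightarrow>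
    ('v \<Rightarrow> 's::finite) \<Rightarrow> ('v \<Rightarrow> 's) \<Rightarrow> real" where
  "comp_kern f g a b = (\<Sum>c\<in>confs. f a c * g c b)"

definition id_kern :: "('v \<Rightarrow> 's) \<Rightarrow> ('v \<Rightarrow> 's) \<Rightarrow> real" where
  "id_kern a b = (if a = b then 1 else 0)"

lemma comp_id_kern:
  assumes "a \<in> confs" "b \<in> confs"
  shows "comp_kern id_kern f a b = f a b" "comp_kern f id_kern a b = f a b"
  using assms by (simp_all add: comp_kern_def id_kern_def mult_delta_left mult_delta_right)

lemma kern_mult: "kern f g ** kern f' g' = kern (comp_kern f f') (comp_kern g g')"
proof -
  have "(kern f g ** kern f' g') $ \<sigma> $ \<tau> = kern (comp_kern f f') (comp_kern g g') $ \<sigma> $ \<tau>" for \<sigma> \<tau>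
  proof -
    let ?l = "\<lambda>\<sigma>. restrict \<sigma> \<Lambda>" and ?r = "\<lambda>\<sigma>. restrict (\<sigma> \<circ> \<rho>) \<Lambda>"
    have "(kern f g ** kern f' g') $ \<sigma> $ \<tau> = complex_of_real
      (\<Sum>\<mu>\<in>UNIV. (f (?l \<sigma>) (?l \<mu>) * f' (?l \<mu>) (?l \<tau>)) * (g (?r \<sigma>) (?r \<mu>) * g' (?r \<mu>) (?r \<tau>)))"
      by (simp add: kern_def matrix_matrix_mult_def mult_ac)
    also have "\<dots> = complex_of_real (\<Sum>a\<in>confs. \<Sum>b\<in>confs.
        (f (?l \<sigma>) a * f' a (?l \<tau>)) * (g (?r \<sigma>) b * g' b (?r \<tau>)))"
      by (subst sum_split[symmetric]) simp
    also have "\<dots> = kern (comp_kern f f') (comp_kern g g') $ \<sigma> $ \<tau>"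
      by (simp add: kern_def comp_kern_def sum_product)
    finally show ?thesis .
  qed
  then show ?thesis by (simp add: vec_eq_iff)
qed

lemma kern_id_id: "kern id_kern id_kern = mat 1"
proof -
  have "\<sigma> = \<tau>" if "restrict \<sigma> \<Lambda> = restrict \<tau> \<Lambda>" "restrict (\<sigma> \<circ> \<rho>) \<Lambda> = restrict (\<tau> \<circ> \<rho>) \<Lambda>"
    for \<sigma> \<tau> :: "'v \<Rightarrow> 's"
  proof
    fix x
    show "\<sigma> x = \<tau> x"
      using fun_cong[OF that(1), of x] fun_cong[OF that(2), of "\<rho> x"] by (cases "x \<in> \<Lambda>") auto
  qed
  then show ?thesis by (auto simp: kern_def id_kern_def mat_def vec_eq_iff)
qed

lemma kern_mult_id:
  "kern f id_kern ** kern id_kern g = kern f g"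
  "kern id_kern g ** kern f id_kern = kern f g"
  by (simp_all add: kern_mult) (simp_all add: kern_def comp_id_kern)

lemma relabel_kern: "relabel \<rho> (kern f g) = kern g f"
  by (simp add: relabel_def kern_def o_assoc[symmetric] vec_eq_iff mult.commute)
    (simp add: o_def)

text \<open>Reality enters here: kernels are real-valued, so multiplying by the reflected operator
  gives \<open>kern f f\<close> without any complex conjugation.\<close>

definition left :: "('v \<Rightarrow> 's::finite) cmatrix \<Rightarrow> bool" where
  "left A \<longleftrightarrow> (\<exists>f. A = kern f id_kern)"

lemma left_add: "left A \<Longrightarrow> left B \<Longrightarrow> left (A + B)"
proof -
  assume "left A" "left B"
  then obtain f g where "A = kern f id_kern" "B = kern g id_kern" by (auto simp: left_def)
  then have "A + B = kern (\<lambda>a b. f a b + g a b) id_kern"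
    by (simp add: kern_def vec_eq_iff algebra_simps)
  then show ?thesis unfolding left_def by blast
qed

lemma left_scale: "left A \<Longrightarrow> left (r *\<^sub>R A)"
proof -
  assume "left A"
  then obtain f where "A = kern f id_kern" by (auto simp: left_def)
  then have "r *\<^sub>R A = kern (\<lambda>a b. r * f a b) id_kern"
    by (simp add: kern_def vec_eq_iff scaleR_conv_of_real[where 'a=complex] algebra_simps)
  then show ?thesis unfolding left_def by blast
qed

lemma left_mat_1: "left (mat 1)"
  unfolding left_def using kern_id_id by metis

lemma left_0: "left 0"
  using left_scale[OF left_mat_1, of 0] by simp

lemma left_sum: "(\<And>x. x \<in> X \<Longrightarrow> left (f x)) \<Longrightarrow> left (\<Sum>x\<in>X. f x)"
  by (induction X rule: infinite_finite_induct) (auto intro: left_add left_0)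

lemma left_mult: "left A \<Longrightarrow> left B \<Longrightarrow> left (A ** B)"
proof -
  assume "left A" "left B"
  then obtain f g where "A = kern f id_kern" "B = kern g id_kern" by (auto simp: left_def)
  then have "A ** B = kern (comp_kern f g) id_kern"
    by (simp add: kern_mult) (simp add: kern_def comp_id_kern)
  then show ?thesis unfolding left_def by blast
qed

lemma left_site_op:
  assumes "x \<in> \<Lambda>" "real_entries A"
  shows "left (site_op A x :: ('v \<Rightarrow> 's::finite) cmatrix)"
proof -
  define f where "f a b = (if \<forall>y\<in>\<Lambda>. y \<noteq> x \<longrightarrow> a y = b y then Re (A $ a x $ b x) else 0)"
    for a b :: "'v \<Rightarrow> 's"
  have A: "complex_of_real (Re (A $ a $ b)) = A $ a $ b" for a b
    using assms(2) by (simp add: real_entries_def)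
  have "(\<forall>y. y \<noteq> x \<longrightarrow> \<sigma> y = \<tau> y) \<longleftrightarrow>
      (\<forall>y\<in>\<Lambda>. y \<noteq> x \<longrightarrow> \<sigma> y = \<tau> y) \<and> restrict (\<sigma> \<circ> \<rho>) \<Lambda> = restrict (\<tau> \<circ> \<rho>) \<Lambda>" for \<sigma> \<tau> :: "'v \<Rightarrow> 's"
  proof -
    have "restrict (\<sigma> \<circ> \<rho>) \<Lambda> = restrict (\<tau> \<circ> \<rho>) \<Lambda> \<longleftrightarrow> (\<forall>y. y \<notin> \<Lambda> \<longrightarrow> \<sigma> y = \<tau> y)"
      by (auto simp: fun_eq_iff restrict_def) (metis half involution)
    then show ?thesis using assms(1) by auto
  qed
  then have "site_op A x = kern f id_kern"
    using assms(1) by (auto simp: vec_eq_iff site_op_nth kern_def f_def id_kern_def A)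
  then show ?thesis unfolding left_def by blast
qed

text \<open>The generator \<open>kern f f\<close> is the product of \<open>kern f id_kern\<close>
  with its reflection. Non-negative scalars are absorbed into \<open>f\<close> as square roots, and
  kernels compose alike on both halves, so the cone is closed under scaling and products.\<close>

inductive_set cone :: "('v \<Rightarrow> 's::finite) cmatrix set" where
  kern: "kern f f \<in> cone"
| add: "A \<in> cone \<Longrightarrow> B \<in> cone \<Longrightarrow> A + B \<in> cone"

lemma cone_left: "left A \<Longrightarrow> A ** relabel \<rho> A \<in> cone"
  by (auto simp: left_def relabel_kern kern_mult_id intro: cone.kern)

lemma cone_scale: "A \<in> cone \<Longrightarrow> 0 \<le> r \<Longrightarrow> r *\<^sub>R A \<in> cone"
proof (induction rule: cone.induct)
  case (kern f)
  have "r *\<^sub>R kern f f = kern (\<lambda>a b. sqrt r * f a b) (\<lambda>a b. sqrt r * f a b)"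
    using kern by (simp add: kern_def vec_eq_iff scaleR_conv_of_real[where 'a=complex] mult_ac
        flip: of_real_mult)
  then show ?case by (simp add: cone.kern)
qed (auto simp: scaleR_right_distrib intro: cone.add)

lemma cone_mat_1: "mat 1 \<in> cone"
  using cone.kern[of id_kern] by (simp add: kern_id_id)

lemma cone_0: "0 \<in> cone"
  using cone_scale[OF cone_mat_1, of 0] by simp

lemma cone_sum: "(\<And>x. x \<in> X \<Longrightarrow> f x \<in> cone) \<Longrightarrow> (\<Sum>x\<in>X. f x) \<in> cone"
  by (induction X rule: infinite_finite_induct) (auto intro: cone.add cone_0)

lemma cone_mult:
  assumes "A \<in> cone" "B \<in> cone"
  shows "A ** B \<in> cone"
  using assms(1)
proof (induction rule: cone.induct)
  case (kern f)
  show ?case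
    using assms(2) 
    by (induction rule: cone.induct) (auto simp: kern_mult cmatrix_mult.add_right intro: cone.intros)
qed (auto simp: cmatrix_mult.add_left intro: cone.add)

lemma cone_power: "A \<in> cone \<Longrightarrow> matrix_power A k \<in> cone"
  by (induction k) (auto intro: cone_mat_1 cone_mult)

text \<open>The trace of \<open>kern f f\<close> factorises over the two halves into the square of a
  real number, the trace of \<open>f\<close>.\<close>

lemma cone_trace: "A \<in> cone \<Longrightarrow> 0 \<le> trace A"
proof (induction rule: cone.induct)
  case (kern f)
  have "trace (kern f f) = complex_of_real
      (\<Sum>\<sigma>\<in>UNIV. (\<lambda>a b. f a a * f b b) (restrict \<sigma> \<Lambda>) (restrict (\<sigma> \<circ> \<rho>) \<Lambda>))"
    by (simp add: trace_def kern_def)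
  also have "\<dots> = complex_of_real ((\<Sum>a\<in>confs. f a a) * (\<Sum>b\<in>confs. f b b))"
    using sum_split[of "\<lambda>a b. f a a * f b b"] by (simp only: sum_product)
  finally show ?case by (simp add: less_eq_complex_def)
qed (simp add: trace_add)

text \<open>Every term of the exponential series stays in the cone, and the non-negative numbers are
  closed under limits.\<close>

lemma cone_trace_exp:
  assumes "A \<in> cone" "B \<in> cone"
  shows "0 \<le> trace (A ** matrix_exp B)"
proof -
  have "(\<lambda>k. trace (A ** ((1 / fact k) *\<^sub>R matrix_power B k))) sums trace (A ** matrix_exp B)"
    by (intro bounded_linear.sums[OF bounded_linear_trace]
        bounded_linear.sums[OF cmatrix_mult.bounded_linear_right] matrix_exp_sums)
  then show ?thesis
    unfolding sums_def
    by (rule nonneg_complex_LIMSEQ)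
       (intro sum_nonneg cone_trace cone_mult cone_scale cone_power assms, simp)
qed

text \<open>With \<open>A' = \<theta> A\<close> one has
  \<open>A + A' + s\<^sup>-\<^sup>1 A A' + s = s\<^sup>-\<^sup>1 (A + s) \<theta> (A + s)\<close>, which lies in the cone.
  The summand \<open>s\<close> only rescales the exponential, and \<open>s\<^sup>-\<^sup>1 A A'\<close> vanishes as \<open>s \<rightarrow> \<infinity>\<close>.\<close>

theorem reflection_positive:
  fixes A :: "('v \<Rightarrow> 's::finite) cmatrix"
  assumes A: "left A" and D: "D \<in> cone" and M: "M \<in> cone"
  shows "0 \<le> trace (M ** matrix_exp (A + relabel \<rho> A + D))"
proof -
  define A' where "A' = relabel \<rho> A"
  define X where "X = A + A' + D"
  have aut: "trace_automorphism (relabel \<rho> :: ('v \<Rightarrow> 's) cmatrix \<Rightarrow> _)"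
    by (rule trace_automorphism_relabel[OF bij_reflection])
  then have lin: "linear (relabel \<rho> :: ('v \<Rightarrow> 's) cmatrix \<Rightarrow> _)"
    and one: "relabel \<rho> (mat 1 :: ('v \<Rightarrow> 's) cmatrix) = mat 1"
    by (auto simp: trace_automorphism_def)
  have nonneg: "0 \<le> trace (M ** matrix_exp (X + (1 / s) *\<^sub>R (A ** A')))" if s: "s > 0" for s :: real
  proof -
    let ?B = "A + s *\<^sub>R mat 1"
    have "relabel \<rho> ?B = A' + s *\<^sub>R mat 1"
      by (simp only: linear_add[OF lin] linear_scale[OF lin] one A'_def)
    then have "(1 / s) *\<^sub>R (?B ** relabel \<rho> ?B) + D = X + (1 / s) *\<^sub>R (A ** A') + s *\<^sub>R mat 1"
      using s by (simp add: X_def cmatrix_mult.add_left cmatrix_mult.add_right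
          cmatrix_mult.scaleR_left cmatrix_mult.scaleR_right scaleR_right_distrib)
    moreover have "(1 / s) *\<^sub>R (?B ** relabel \<rho> ?B) + D \<in> cone"
      using s by (intro cone.add cone_scale cone_left left_add left_scale left_mat_1 A D) auto
    ultimately have "0 \<le> trace (M ** matrix_exp (X + (1 / s) *\<^sub>R (A ** A') + s *\<^sub>R mat 1))"
      using cone_trace_exp[OF M] by metis
    also have "\<dots> = exp s *\<^sub>R trace (M ** matrix_exp (X + (1 / s) *\<^sub>R (A ** A')))"
      by (simp only: matrix_exp_add_scalar cmatrix_mult.scaleR_right linear_scale[OF linear_trace])
    finally show ?thesis
      by (simp add: less_eq_complex_def zero_le_mult_iff)
  qed
  have "(\<lambda>n. X + (1 / real (Suc n)) *\<^sub>R (A ** A')) \<longlonglongrightarrow> X + 0 *\<^sub>R (A ** A')"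
    by (intro tendsto_intros LIMSEQ_Suc[OF lim_1_over_n])
  then have "(\<lambda>n. matrix_exp (X + (1 / real (Suc n)) *\<^sub>R (A ** A'))) \<longlonglongrightarrow> matrix_exp X"
    using isCont_tendsto_compose[OF isCont_matrix_exp] by simp
  then have "(\<lambda>n. trace (M ** matrix_exp (X + (1 / real (Suc n)) *\<^sub>R (A ** A')))) \<longlonglongrightarrow> trace (M ** matrix_exp X)"
    by (intro bounded_linear.tendsto[OF bounded_linear_trace]
        bounded_linear.tendsto[OF cmatrix_mult.bounded_linear_right])
  then show ?thesis
    unfolding X_def A'_def[symmetric]
    by (rule nonneg_complex_LIMSEQ) (use nonneg in \<open>simp add: X_def\<close>)
qed

lemma left_exchange:
  assumes "real_entries S1" "real_entries (mat \<i> ** S2)" "real_entries S3" "x \<in> \<Lambda>" "y \<in> \<Lambda>"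
  shows "left (exchange S1 S2 S3 u x y)"
  unfolding exchange_imaginary by (intro left_add left_scale left_mult left_site_op assms)

lemma left_edge_exchange:
  assumes "real_entries S1" "real_entries (mat \<i> ** S2)" "real_entries S3" "e \<subseteq> \<Lambda>"
  shows "left (edge_exchange S1 S2 S3 u e)"
  unfolding edge_exchange_def using assms by (intro left_scale left_sum left_exchange) auto

lemma cone_exchange:
  assumes "real_entries S1" "real_entries (mat \<i> ** S2)" "real_entries S3" "x \<in> \<Lambda>" "u \<le> 0"
  shows "exchange S1 S2 S3 u x (\<rho> x) \<in> cone"
proof -
  have "site_op A x ** site_op A (\<rho> x) \<in> cone" if "real_entries A" for A
    using cone_left[OF left_site_op[OF assms(4) that]]
    by (simp add: relabel_site_op[OF bij_reflection])
  then show ?thesis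
    unfolding exchange_imaginary using assms by (intro cone.add cone_scale) auto
qed

text \<open>Edges inside \<open>\<Lambda>\<close> make up \<open>A\<close>, their mirror images make
  up its reflection, and the edges cut by the plane make up \<open>D\<close>. The signs of
  \<open>u\<close> and \<open>c\<close> put \<open>D\<close> into the cone.\<close>

theorem reflection_positive_edges:
  assumes real: "real_entries S1" "real_entries (mat \<i> ** S2)" "real_entries S3"
    and "u \<le> 0" "0 \<le> c" and M: "M \<in> cone"
    and E: "finite E" "\<And>e. e \<in> E \<Longrightarrow> e \<noteq> {}" "\<And>e. e \<in> E \<Longrightarrow> \<rho> ` e \<in> E"
      "\<And>e. e \<in> E \<Longrightarrow> e \<subseteq> \<Lambda> \<or> e \<subseteq> - \<Lambda> \<or> (\<exists>x\<in>\<Lambda>. e = {x, \<rho> x})"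
  shows "0 \<le> trace (M ** matrix_exp (c *\<^sub>R (\<Sum>e\<in>E. edge_exchange S1 S2 S3 u e)))"
proof -
  let ?ex = "edge_exchange S1 S2 S3 u :: 'v set \<Rightarrow> _"
  define E1 where "E1 = {e \<in> E. e \<subseteq> \<Lambda>}"
  define E2 where "E2 = {e \<in> E. e \<subseteq> - \<Lambda>}"
  define E3 where "E3 = E - E1 - E2"
  define A where "A = c *\<^sub>R (\<Sum>e\<in>E1. ?ex e)"
  define D where "D = c *\<^sub>R (\<Sum>e\<in>E3. ?ex e)"
  have fin: "finite E1" "finite E2" "finite E3" using E(1) by (auto simp: E1_def E2_def E3_def)
  have "left A"
    unfolding A_def using real by (intro left_scale left_sum left_edge_exchange) (auto simp: E1_def)
  have "?ex e \<in> cone" if e: "e \<in> E3" for e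
  proof -
    obtain x where x: "x \<in> \<Lambda>" "e = {x, \<rho> x}"
      using e E(4)[of e] by (auto simp: E1_def E2_def E3_def)
    then have "x \<noteq> \<rho> x" using half[of x] by metis
    then show ?thesis
      using x real \<open>u \<le> 0\<close> by (simp add: edge_exchange_doubleton cone_exchange)
  qed
  then have "D \<in> cone"
    unfolding D_def by (intro cone_scale cone_sum \<open>0 \<le> c\<close>)
  have aut: "trace_automorphism (relabel \<rho> :: ('v \<Rightarrow> 'a) cmatrix \<Rightarrow> _)"
    by (rule trace_automorphism_relabel[OF bij_reflection])
  then have lin: "linear (relabel \<rho> :: ('v \<Rightarrow> 'a) cmatrix \<Rightarrow> _)"
    and mult: "\<And>A B :: ('v \<Rightarrow> 'a) cmatrix. relabel \<rho> (A ** B) = relabel \<rho> A ** relabel \<rho> B"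
    by (auto simp: trace_automorphism_def)
  have "relabel \<rho> (?ex e) = ?ex (\<rho> ` e)" for e
    by (rule edge_exchange_map[OF lin mult]) (auto simp: relabel_site_op[OF bij_reflection] inj_reflection)
  then have "relabel \<rho> A = c *\<^sub>R (\<Sum>e\<in>E1. ?ex (\<rho> ` e))"
    by (simp add: A_def linear_scale[OF lin] linear_sum[OF lin])
  also have "(\<Sum>e\<in>E1. ?ex (\<rho> ` e)) = (\<Sum>e\<in>E2. ?ex e)"
    by (rule sum.reindex_bij_witness[of _ "(`) \<rho>" "(`) \<rho>"])
       (use E(3) in \<open>auto simp: E1_def E2_def image_image\<close>)
  finally have "relabel \<rho> A = c *\<^sub>R (\<Sum>e\<in>E2. ?ex e)" .
  moreover have "(\<Sum>e\<in>E. ?ex e) = (\<Sum>e\<in>E1. ?ex e) + (\<Sum>e\<in>E2. ?ex e) + (\<Sum>e\<in>E3. ?ex e)"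
  proof -
    have "E = E1 \<union> E2 \<union> E3" by (auto simp: E1_def E2_def E3_def)
    \<comment> \<open>Only the empty set could lie in both halves.\<close>
    moreover have "E1 \<inter> E2 = {}" using E(2) by (fastforce simp: E1_def E2_def)
    moreover have "(E1 \<union> E2) \<inter> E3 = {}" by (auto simp: E3_def)
    ultimately show ?thesis using fin by (simp add: sum.union_disjoint)
  qed
  ultimately have "c *\<^sub>R (\<Sum>e\<in>E. ?ex e) = A + relabel \<rho> A + D"
    by (simp add: A_def D_def scaleR_right_distrib)
  then show ?thesis
    using reflection_positive[OF \<open>left A\<close> \<open>D \<in> cone\<close> M] by simp
qed

end

section \<open>Reflections of the torus\<close>

lemma to_int_of_int_mod_ring:
  "0 \<le> k \<Longrightarrow> k < int CARD('l) \<Longrightarrow> to_int_mod_ring (of_int k :: 'l::nontriv mod_ring) = k"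
  by (simp add: of_int_of_int_mod_ring)

lemma of_int_to_int_mod_ring: "of_int (to_int_mod_ring a) = (a :: 'l::nontriv mod_ring)"
  by (simp add: of_int_of_int_mod_ring)

lemma to_int_mod_ring_bounds: "0 \<le> to_int_mod_ring a" "to_int_mod_ring a < int CARD('l)"
  for a :: "'l::nontriv mod_ring"
  using range_to_int_mod_ring[where 'a='l] by auto

lemma to_int_mod_ring_minus: 
  "to_int_mod_ring (- 1 - a) = int CARD('l) - 1 - to_int_mod_ring a" for a :: "'l::nontriv mod_ring"
proof -
  have "of_int (int CARD('l) - 1 - to_int_mod_ring a) = - 1 - a"
    by (simp add: of_int_to_int_mod_ring)
  then show ?thesis
    using to_int_of_int_mod_ring[of "int CARD('l) - 1 - to_int_mod_ring a", where 'l='l]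
      to_int_mod_ring_bounds[of a] by simp
qed

lemma to_int_mod_ring_add_1:
  "to_int_mod_ring (a + 1) = (if to_int_mod_ring a = int CARD('l) - 1 then 0 else to_int_mod_ring a + 1)"
  for a :: "'l::nontriv mod_ring"
proof (cases "to_int_mod_ring a = int CARD('l) - 1")
  case True
  then have "a = of_int (int CARD('l) - 1)" using of_int_to_int_mod_ring by metis
  then show ?thesis using True by simp
next
  case False
  have "of_int (to_int_mod_ring a + 1) = a + 1"
    by (simp add: of_int_to_int_mod_ring)
  then show ?thesis
    using False to_int_of_int_mod_ring[of "to_int_mod_ring a + 1", where 'l='l]
      to_int_mod_ring_bounds[of a] by simp
qed

text \<open>On representatives of coordinate i this is n -> L - 1 - n. For even L it is the
  reflection in the planes halfway between L - 1 and 0 and halfway between L/2 - 1 and L/2.\<close>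

definition mirror :: "'d \<Rightarrow> 'l::nontriv mod_ring ^ 'd::finite \<Rightarrow> 'l mod_ring ^ 'd" where
  "mirror i x = (\<chi> j. if j = i then - 1 - x $ j else x $ j)"

definition half_torus :: "'d \<Rightarrow> ('l::nontriv mod_ring ^ 'd::finite) set" where
  "half_torus i = {x. 2 * to_int_mod_ring (x $ i) < int CARD('l)}"

lemma mirror_add_axis: "w $ i = 0 \<Longrightarrow> mirror i (w + axis i a) = w + axis i (- 1 - a)"
  by (simp add: mirror_def vec_eq_iff axis_def)

lemma reflection_mirror:
  assumes "even CARD('l)"
  shows "reflection (mirror i) (half_torus i :: ('l::nontriv mod_ring ^ 'd::finite) set)"
proof
  fix x :: "'l mod_ring ^ 'd"
  show "mirror i (mirror i x) = x" by (simp add: mirror_def vec_eq_iff)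
  have "even (int CARD('l))" using assms by simp
  then show "mirror i x \<in> half_torus i \<longleftrightarrow> x \<notin> half_torus i"
    by (auto simp: mirror_def half_torus_def to_int_mod_ring_minus elim!: evenE)
qed

lemma mirror_torus_edges:
  assumes "e \<in> torus_edges"
  shows "mirror i ` e \<in> torus_edges"
proof -
  obtain x j where e: "e = {x, x + axis j 1}" using assms by (auto simp: torus_edges_def)
  show ?thesis
  proof (cases "j = i")
    case True
    have "mirror i x = mirror i (x + axis j 1) + axis j 1"
      using True by (simp add: mirror_def vec_eq_iff axis_def)
    then have "mirror i ` e = {mirror i (x + axis j 1), mirror i (x + axis j 1) + axis j 1}"
      by (auto simp: e)
    then show ?thesis unfolding torus_edges_def by blast
  next
    case False
    have "mirror i (x + axis j 1) = mirror i x + axis j 1"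
      using False by (auto simp: mirror_def vec_eq_iff axis_def)
    then have "mirror i ` e = {mirror i x, mirror i x + axis j 1}" by (simp add: e)
    then show ?thesis unfolding torus_edges_def by blast
  qed
qed

text \<open>Only edges in direction i can join the two halves. They lead from coordinate L/2 - 1 to
  L/2 or, around the torus, from L - 1 to 0, and the mirror exchanges the ends of both
  kinds.\<close>

lemma torus_edges_mirror_cases:
  assumes "even CARD('l)" and "e \<in> (torus_edges :: ('l::nontriv mod_ring ^ 'd::finite) set set)"
  shows "e \<subseteq> half_torus i \<or> e \<subseteq> - half_torus i \<or> (\<exists>x\<in>half_torus i. e = {x, mirror i x})"
proof -
  obtain x j where e: "e = {x, x + axis j 1}" using assms(2) by (auto simp: torus_edges_def)
  let ?n = "to_int_mod_ring (x $ i)" and ?y = "x + axis j 1"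
  have even: "even (int CARD('l))" using assms(1) by simp
  show ?thesis
  proof (cases "j = i")
    case False
    then have "?y $ i = x $ i" by (simp add: axis_def)
    then show ?thesis by (auto simp: e half_torus_def)
  next
    case True
    then have y: "?y $ i = x $ i + 1" by (simp add: axis_def)
    consider "x \<in> half_torus i \<longleftrightarrow> ?y \<in> half_torus i"
      | "x \<in> half_torus i" "?y \<notin> half_torus i" | "x \<notin> half_torus i" "?y \<in> half_torus i"
      by blast
    then show ?thesis
    proof cases
      case 1
      then show ?thesis by (auto simp: e)
    next
      case 2
      from 2 have "2 * ?n < int CARD('l)" "\<not> 2 * to_int_mod_ring (x $ i + 1) < int CARD('l)"
        unfolding half_torus_def mem_Collect_eq y by blast+
      then have "int CARD('l) - 1 - ?n = to_int_mod_ring (x $ i + 1)"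
        using even to_int_mod_ring_bounds[of "x $ i"]
        by (auto simp: to_int_mod_ring_add_1 split: if_splits elim!: evenE)
      then have "- 1 - x $ i = x $ i + 1"
        unfolding to_int_mod_ring_minus[symmetric] by (simp only: to_int_mod_ring_hom.eq_iff)
      then have "?y = mirror i x"
        using True by (auto simp: mirror_def vec_eq_iff axis_def add.commute)
      then have "e = {x, mirror i x}" by (simp only: e)
      with 2(1) show ?thesis by (intro disjI2 bexI)
    next
      case 3
      from 3 have "\<not> 2 * ?n < int CARD('l)" "2 * to_int_mod_ring (x $ i + 1) < int CARD('l)"
        unfolding half_torus_def mem_Collect_eq y by blast+
      then have "?n = int CARD('l) - 1"
        by (auto simp: to_int_mod_ring_add_1 split: if_splits)
      then have "to_int_mod_ring (x $ i + 1) = 0" by (simp add: to_int_mod_ring_add_1)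
      then have "x $ i + 1 = 0" by simp
      then have "x = mirror i ?y"
        using True by (auto simp: mirror_def vec_eq_iff axis_def eq_neg_iff_add_eq_0)
      then have "{?y, x} = {?y, mirror i ?y}" by (rule arg_cong[where f="\<lambda>z. {?y, z}"])
      moreover have "e = {?y, x}" by (auto simp: e)
      ultimately have "e = {?y, mirror i ?y}" by (simp only:)
      with 3(2) show ?thesis by (intro disjI2 bexI)
    qed
  qed
qed

lemma translate_torus_edges:
  assumes "e \<in> torus_edges"
  shows "(\<lambda>x. x + t) ` e \<in> torus_edges"
proof -
  obtain x j where "e = {x, x + axis j 1}" using assms by (auto simp: torus_edges_def)
  then have "(\<lambda>x. x + t) ` e = {x + t, x + t + axis j 1}" by (simp add: algebra_simps)
  then show ?thesis unfolding torus_edges_def by blast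
qed

text \<open>Since \<open>a / 0 = 0\<close>, the strict positivity of the partition function is never needed.\<close>

lemma nonneg_complex_divide: "0 \<le> a \<Longrightarrow> 0 \<le> b \<Longrightarrow> 0 \<le> (a / b :: complex)"
  by (auto simp: less_eq_complex_def Re_divide Im_divide)

section \<open>Discrete convexity with symmetry\<close>

lemma convex_symmetric_antimono:
  fixes g :: "nat \<Rightarrow> real"
  assumes convex: "\<And>s. s + 2 < h \<Longrightarrow> 2 * g (s + 1) \<le> g s + g (s + 2)"
    and symmetric: "\<And>s. s < h \<Longrightarrow> g (h - 1 - s) = g s"
    and "m \<le> n" "2 * n + 1 < h"
  shows "g n \<le> g m"
  using assms(3,4)
proof (induction n rule: dec_induct)
  case (step s)
  \<comment> \<open>By convexity the increments are non-decreasing.\<close>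
  have slope: "g (s + 1) - g s \<le> g (t + 1) - g t" if "s \<le> t" "t + 1 < h" for t
    using that
  proof (induction t rule: dec_induct)
    case (step t)
    then show ?case using convex[of t] by (simp add: algebra_simps)
  qed simp
  \<comment> \<open>By symmetry the increment at h - 2 - s is the negative of the increment at s.
    Since s <= h - 2 - s, the latter is at most its own negative, hence non-positive.\<close>
  have "h - 2 - s + 1 = h - 1 - s" "h - 2 - s = h - 1 - (s + 1)" using step.prems by auto
  then have "g (h - 2 - s + 1) = g s" "g (h - 2 - s) = g (s + 1)"
    using symmetric[of s] symmetric[of "s + 1"] step.prems by auto
  moreover have "s \<le> h - 2 - s" "h - 2 - s + 1 < h" using step.prems by auto
  ultimately have "g (s + 1) - g s \<le> g s - g (s + 1)"
    using slope by metis
  then show ?case using step by auto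
qed simp

text \<open>The complex order demands equal imaginary parts; these come from applying the real lemma
  to both Im and -Im.\<close>

lemma convex_symmetric_antimono_complex:
  fixes g :: "nat \<Rightarrow> complex"
  assumes convex: "\<And>s. s + 2 < h \<Longrightarrow> 2 * g (s + 1) \<le> g s + g (s + 2)"
    and symmetric: "\<And>s. s < h \<Longrightarrow> g (h - 1 - s) = g s"
    and "m \<le> n" "2 * n + 1 < h"
  shows "g n \<le> g m"
proof -
  have "Re (g n) \<le> Re (g m)"
    by (rule convex_symmetric_antimono[of h _ m n])
       (use convex symmetric assms(3,4) in \<open>auto simp: less_eq_complex_def\<close>)
  moreover have "Im (g n) \<le> Im (g m)"
    by (rule convex_symmetric_antimono[of h _ m n])
       (use convex symmetric assms(3,4) in \<open>auto simp: less_eq_complex_def\<close>)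
  moreover have "- Im (g n) \<le> - Im (g m)"
    by (rule convex_symmetric_antimono[of h "\<lambda>n. - Im (g n)" m n])
       (use convex symmetric assms(3,4) in \<open>auto simp: less_eq_complex_def\<close>)
  ultimately show ?thesis by (simp add: less_eq_complex_def)
qed

section \<open>Two-point functions and their midpoint inequalities\<close>

locale real_spin_model =
  fixes T1 T2 T3 :: "'s::finite cmatrix" and u \<beta> :: real
  assumes real: "real_entries T1" "real_entries (mat \<i> ** T2)" "real_entries T3"
    and u: "u \<le> 0" and \<beta>: "0 \<le> \<beta>"
begin

abbreviation "G \<equiv> spin_corr T1 T2 T3 u \<beta>"

definition corr :: "'l::nontriv mod_ring ^ 'd::finite \<Rightarrow> 'l mod_ring ^ 'd \<Rightarrow> complex" where
  "corr x y = gibbs_state \<beta> (hamiltonian T1 T2 T3 u) (site_op T3 x ** site_op T3 y)"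

lemma corr_map:
  fixes p :: "'l::nontriv mod_ring ^ 'd::finite \<Rightarrow> 'l mod_ring ^ 'd"
  assumes "bij p" "\<And>e. e \<in> torus_edges \<Longrightarrow> p ` e \<in> torus_edges"
  shows "corr (p x) (p y) = corr x y"
  unfolding corr_def
  by (rule gibbs_hamiltonian_map[where p=p and \<Phi>="relabel p", OF trace_automorphism_relabel[OF assms(1)]
    relabel_site_op[OF assms(1)] relabel_site_op[OF assms(1)] relabel_site_op[OF assms(1)]
    bij_is_inj[OF assms(1)] assms(2)])

text \<open>Translations are symmetries of the Hamiltonian.\<close>

lemma corr_eq: "corr x y = G (y - x)"
proof -
  have "corr (0 + x) (y - x + x) = corr 0 (y - x)"
    by (rule corr_map[of "\<lambda>z. z + x"]) (auto intro!: o_bij[of "\<lambda>z. z - x"] translate_torus_edges)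
  then show ?thesis by (simp add: corr_def spin_corr_def)
qed

lemma corr_commute: "corr x y = corr y x"
  by (cases "x = y") (simp_all add: corr_def site_op_commute)

lemma G_minus: "G (- z) = G z"
  using corr_commute[of 0 z] by (simp add: corr_eq)

text \<open>The mirror sends the origin to -e_i; translating back leaves only coordinate i
  negated.\<close>

lemma G_mirror:
  assumes "even CARD('l)" "w $ i = 0"
  shows "G (w + axis i (- n)) = G (w + axis i n :: 'l::nontriv mod_ring ^ 'd::finite)"
proof -
  interpret reflection "mirror i" "half_torus i :: ('l mod_ring ^ 'd) set"
    by (rule reflection_mirror[OF assms(1)])
  have "corr (mirror i 0) (mirror i (w + axis i n)) = corr 0 (w + axis i n)"
    by (rule corr_map[OF bij_reflection mirror_torus_edges])
  moreover have "mirror i (w + axis i n) - mirror i 0 = w + axis i (- n)"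
    using assms(2) by (simp add: mirror_def vec_eq_iff axis_def)
  ultimately show ?thesis by (simp add: corr_eq)
qed

text \<open>Inversion combined with the negation of coordinate i negates only the part orthogonal to
  e_i.\<close>

lemma G_minus_add:
  assumes "even CARD('l)" "w $ i = 0"
  shows "G (axis i n - w) = G (w + axis i n :: 'l::nontriv mod_ring ^ 'd::finite)"
proof -
  have "- (axis i n - w) = w + axis i (- n)"
    by (simp add: vec_eq_iff axis_def)
  then show ?thesis using G_minus[of "axis i n - w"] G_mirror[OF assms, of n] by metis
qed

text \<open>The mirror image of coordinate b is -1 - b, which differs from a by -(1 + a + b);
  \<open>G_mirror\<close> removes the sign.\<close>

lemma corr_mirror:
  assumes "even CARD('l)" "w $ i = 0" "v $ i = 0"
  shows "corr (w + axis i a) (mirror i (v + axis i b)) =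
    G (v - w + axis i (1 + a + b) :: 'l::nontriv mod_ring ^ 'd::finite)"
proof -
  have "mirror i (v + axis i b) - (w + axis i a) = v - w + axis i (- (1 + a + b))"
    unfolding mirror_add_axis[OF assms(3)] by (simp add: vec_eq_iff axis_def)
  moreover have "(v - w) $ i = 0" using assms by simp
  ultimately show ?thesis by (simp only: corr_eq G_mirror[OF assms(1)])
qed

lemma gibbs_mirror_nonneg:
  fixes A :: "(('l::nontriv mod_ring ^ 'd::finite) \<Rightarrow> 's) cmatrix"
  assumes "even CARD('l)" "reflection.left (mirror i) (half_torus i) A"
  shows "0 \<le> gibbs_state \<beta> (hamiltonian T1 T2 T3 u) (A ** relabel (mirror i) A)"
proof -
  interpret reflection "mirror i" "half_torus i :: ('l mod_ring ^ 'd) set"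
    by (rule reflection_mirror[OF assms(1)])
  have nonneg: "0 \<le> trace (M ** matrix_exp ((- \<beta>) *\<^sub>R hamiltonian T1 T2 T3 u))" if M: "M \<in> cone" for M
  proof -
    let ?E = "torus_edges :: ('l mod_ring ^ 'd) set set"
    have H: "(- \<beta>) *\<^sub>R hamiltonian T1 T2 T3 u = (2 * \<beta>) *\<^sub>R (\<Sum>e\<in>?E. edge_exchange T1 T2 T3 u e)"
      unfolding hamiltonian_def scaleR_scaleR by (simp only: mult_minus_left mult_minus_right minus_minus mult.commute)
    show ?thesis
      unfolding H
    proof (rule reflection_positive_edges[OF real u _ M])
      fix e assume e: "e \<in> ?E"
      then show "e \<noteq> {}" by (auto simp: torus_edges_def)
      show "mirror i ` e \<in> ?E" using e by (rule mirror_torus_edges)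
      show "e \<subseteq> half_torus i \<or> e \<subseteq> - half_torus i \<or> (\<exists>x\<in>half_torus i. e = {x, mirror i x})"
        using assms(1) e by (rule torus_edges_mirror_cases)
    qed (use \<beta> in simp_all)
  qed
  show ?thesis
    unfolding gibbs_state_def partition_function_def
    by (rule nonneg_complex_divide[OF nonneg[OF cone_left[OF assms(2)]]
        nonneg[OF cone_mat_1, unfolded matrix_mul_lid]])
qed

text \<open>Reflection positivity for a real linear combination of third spin components: the
  correlations between points and mirror images form a positive semidefinite quadratic form.\<close>

lemma gibbs_mirror_nonneg_sum:
  fixes x :: "nat \<Rightarrow> 'l::nontriv mod_ring ^ 'd::finite"
  assumes "even CARD('l)" "\<And>k. k < N \<Longrightarrow> x k \<in> half_torus i"
  shows "0 \<le> (\<Sum>k<N. \<Sum>l<N. (w k * w l) *\<^sub>R corr (x k) (mirror i (x l)))"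
proof -
  interpret reflection "mirror i" "half_torus i :: ('l mod_ring ^ 'd) set"
    by (rule reflection_mirror[OF assms(1)])
  let ?A = "\<Sum>k<N. w k *\<^sub>R site_op T3 (x k)"
  have aut: "trace_automorphism (relabel (mirror i) :: (('l mod_ring ^ 'd) \<Rightarrow> 's) cmatrix \<Rightarrow> _)"
    by (rule trace_automorphism_relabel[OF bij_reflection])
  then have lin: "linear (relabel (mirror i) :: (('l mod_ring ^ 'd) \<Rightarrow> 's) cmatrix \<Rightarrow> _)"
    by (simp add: trace_automorphism_def)
  have "relabel (mirror i) ?A = (\<Sum>k<N. w k *\<^sub>R site_op T3 (mirror i (x k)))"
    by (simp add: linear_sum[OF lin] linear_scale[OF lin] relabel_site_op[OF bij_reflection])
  then have "?A ** relabel (mirror i) ?A =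
      (\<Sum>k<N. \<Sum>l<N. (w k * w l) *\<^sub>R (site_op T3 (x k) ** site_op T3 (mirror i (x l))))"
    by (simp only: cmatrix_mult.sum_left)
      (simp only: cmatrix_mult.sum_right cmatrix_mult.scaleR_left cmatrix_mult.scaleR_right
        scaleR_scaleR mult.commute)
  then have "gibbs_state \<beta> (hamiltonian T1 T2 T3 u) (?A ** relabel (mirror i) ?A) =
      (\<Sum>k<N. \<Sum>l<N. (w k * w l) *\<^sub>R corr (x k) (mirror i (x l)))"
    by (simp only: linear_sum[OF linear_gibbs_state] linear_scale[OF linear_gibbs_state] corr_def)
  moreover have "left ?A"
    by (intro left_sum left_scale left_site_op assms(2) real) simp
  then have "0 \<le> gibbs_state \<beta> (hamiltonian T1 T2 T3 u) (?A ** relabel (mirror i) ?A)"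
    by (rule gibbs_mirror_nonneg[OF assms(1)])
  ultimately show ?thesis by (simp only:)
qed

text \<open>The quadratic form is taken at the points a e_i and v + b e_i with weights 1 and -1. In
  its diagonal terms v cancels, and the two mixed terms agree by \<open>G_minus_add\<close>.\<close>

lemma G_midpoint:
  fixes v :: "'l::nontriv mod_ring ^ 'd::finite"
  assumes "even CARD('l)" "v $ i = 0"
    and ab: "2 * to_int_mod_ring a < int CARD('l)" "2 * to_int_mod_ring b < int CARD('l)"
  shows "2 * G (v + axis i (1 + a + b)) \<le> G (axis i (1 + a + a)) + G (axis i (1 + b + b))"
proof -
  let ?x = "\<lambda>k :: nat. (if k = 0 then 0 else v) + axis i (if k = 0 then a else b)"
  let ?w = "\<lambda>k :: nat. if k = 0 then 1 else -1"
  have t: "corr (?x k) (mirror i (?x l)) = G ((if l = 0 then 0 else v) - (if k = 0 then 0 else v) +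
      axis i (1 + (if k = 0 then a else b) + (if l = 0 then a else b)))" for k l
    by (rule corr_mirror[OF assms(1)]) (auto simp: assms(2))
  have "0 \<le> (\<Sum>k<2. \<Sum>l<2. (?w k * ?w l) *\<^sub>R corr (?x k) (mirror i (?x l)))"
    by (rule gibbs_mirror_nonneg_sum[OF assms(1)]) (use ab assms(2) in \<open>auto simp: half_torus_def axis_def\<close>)
  also have "\<dots> = G (axis i (1 + a + a)) + G (axis i (1 + b + b)) - 2 * G (v + axis i (1 + a + b))"
  proof -
    have "G (axis i (1 + b + a) - v) = G (v + axis i (1 + a + b))"
      using G_minus_add[OF assms(1,2), of "1 + b + a"] by (simp only: ac_simps)
    then show ?thesis unfolding t by (simp add: eval_nat_numeral)
  qed
  finally show ?thesis by (simp only: diff_ge_0_iff_ge)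
qed

lemma G_pair_midpoint:
  fixes y :: "'l::nontriv mod_ring ^ 'd::finite"
  assumes "even CARD('l)" "y $ i = 0"
    and ab: "2 * to_int_mod_ring a < int CARD('l)" "2 * to_int_mod_ring b < int CARD('l)"
  defines "f \<equiv> \<lambda>n. G (y + axis i n) + G (axis i n)"
  shows "2 * f (1 + a + b) \<le> f (1 + a + a) + f (1 + b + b)"
proof -
  \<comment> \<open>The parity of k selects the base point 0 or y, and k < 2 selects the height a or
    b. The weights depend on the height only, so the form splits into four 2 by 2 blocks.\<close>
  let ?x = "\<lambda>k :: nat. (if even k then 0 else y) + axis i (if k < 2 then a else b)"
  let ?w = "\<lambda>k :: nat. if k < 2 then 1 else -1"
  let ?t = "\<lambda>k l. corr (?x k) (mirror i (?x l))"
  have t: "?t k l = G ((if even l then 0 else y) - (if even k then 0 else y) +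
      axis i (1 + (if k < 2 then a else b) + (if l < 2 then a else b)))" for k l
    by (rule corr_mirror[OF assms(1)]) (auto simp: assms(2))
  \<comment> \<open>In a block the base points agree in two terms and differ by y or -y in the other
    two, which are equal by \<open>G_minus_add\<close>.\<close>
  have block: "?t k l + ?t k (Suc l) + ?t (Suc k) l + ?t (Suc k) (Suc l) =
      2 * f (1 + (if k < 2 then a else b) + (if l < 2 then a else b))" if "even k" "even l" for k l
  proof -
    have "Suc k < 2 \<longleftrightarrow> k < 2" "Suc l < 2 \<longleftrightarrow> l < 2" using that by (auto elim!: evenE)
    then show ?thesis
      unfolding t f_def using that by (simp add: G_minus_add[OF assms(1,2)])
  qed
  have "0 \<le> (\<Sum>k<4. \<Sum>l<4. (?w k * ?w l) *\<^sub>R ?t k l)"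
    by (rule gibbs_mirror_nonneg_sum[OF assms(1)]) (use ab assms(2) in \<open>auto simp: half_torus_def axis_def\<close>)
  also have "\<dots> = (?t 0 0 + ?t 0 (Suc 0) + ?t (Suc 0) 0 + ?t (Suc 0) (Suc 0))
      - (?t 0 2 + ?t 0 (Suc 2) + ?t (Suc 0) 2 + ?t (Suc 0) (Suc 2))
      - (?t 2 0 + ?t 2 (Suc 0) + ?t (Suc 2) 0 + ?t (Suc 2) (Suc 0))
      + (?t 2 2 + ?t 2 (Suc 2) + ?t (Suc 2) 2 + ?t (Suc 2) (Suc 2))"
    by (simp add: eval_nat_numeral)
  also have "\<dots> = 2 * (f (1 + a + a) + f (1 + b + b) - 2 * f (1 + a + b))"
  proof -
    have "1 + b + a = 1 + a + b" by (simp only: ac_simps)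
    then show ?thesis
      by (simp only: block[OF even_zero even_zero] block[OF even_zero even_numeral]
          block[OF even_numeral even_zero] block[OF even_numeral even_numeral]) (simp add: algebra_simps)
  qed
  finally show ?thesis by (simp add: less_eq_complex_def)
qed

end

section \<open>Correlation inequalities for the spin model\<close>

theorem theorem3p1:
  fixes S1 S2 S3 :: "'s::finite cmatrix"
    and S \<beta> u :: real
    and i :: "'d::finite"
    and c :: "'l::nontriv mod_ring ^ 'd \<Rightarrow> complex"
  defines "c \<equiv> spin_corr S1 S2 S3 u \<beta>"
  assumes "0 \<le> \<beta>"
    and "even CARD('l)"
    and "0 < S" and "real CARD('s) = 2 * S + 1"
    and "spin_operators S S1 S2 S3"
    and "2 \<le> CARD('d)"
    and "-1 \<le> u" and "u \<le> 0"
  shows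
    "(\<forall>z. z \<noteq> 0 \<longrightarrow>
        (odd (to_int_mod_ring (z $ i)) \<longrightarrow> c z \<le> c (axis i (z $ i))) \<and>
        (even (to_int_mod_ring (z $ i)) \<and> to_int_mod_ring (z $ i) \<noteq> 0 \<longrightarrow>
           c z \<le> (1/2) * (c (axis i (z $ i + 1)) + c (axis i (z $ i - 1))))) \<and>
     (\<forall>y. y $ i = 0 \<longrightarrow>
        antimono_on {n::nat. odd n \<and> 0 < n \<and> 2 * n < CARD('l)}
          (\<lambda>n. c (y + axis i (of_nat n)) + c (axis i (of_nat n))))"
proof -
  obtain T1 T2 T3 :: "'s cmatrix" where T: "real_entries T1" "real_entries (mat \<i> ** T2)" "real_entries T3"
    and c: "c = spin_corr T1 T2 T3 u \<beta>"
    unfolding c_def by (rule spin_corr_real_basis[OF assms(6,4,5)])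
  interpret real_spin_model T1 T2 T3 u \<beta>
    by unfold_locales (use T assms in auto)
  have small: "2 * to_int_mod_ring (of_nat k :: 'l mod_ring) < int CARD('l)" if "2 * k < CARD('l)" for k
    using to_int_of_int_mod_ring[of "int k", where 'l='l] that by simp
  have odd: "c z \<le> c (axis i (z $ i))" if "odd (to_int_mod_ring (z $ i))" for z
  proof -
    from that obtain k where "to_int_mod_ring (z $ i) = 2 * k + 1" by (auto elim: oddE)
    then obtain m where m: "to_int_mod_ring (z $ i) = 2 * int m + 1"
      using to_int_mod_ring_bounds[of "z $ i"] nonneg_int_cases[of k] by auto
    then have "2 * m < CARD('l)" using to_int_mod_ring_bounds[of "z $ i"] by linarith
    have z: "z $ i = 1 + of_nat m + of_nat m"
      using of_int_to_int_mod_ring[of "z $ i"] by (simp add: m)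
    \<comment> \<open>For coordinate 2 m + 1 the choice a = b = m makes both outer terms of
      \<open>G_midpoint\<close> equal to the value on the axis; \<open>v\<close> is the part of z
      orthogonal to e_i.\<close>
    define v where "v = z - axis i (z $ i)"
    have "v $ i = 0" "z = v + axis i (z $ i)" by (simp_all add: v_def)
    with G_midpoint[OF assms(3), of v i "of_nat m" "of_nat m"] small[OF \<open>2 * m < CARD('l)\<close>]
    have "2 * c z \<le> 2 * c (axis i (z $ i))"
      by (simp add: c flip: z)
    then show ?thesis by (simp add: less_eq_complex_def)
  qed
  have even: "c z \<le> (1/2) * (c (axis i (z $ i + 1)) + c (axis i (z $ i - 1)))"
    if ev: "even (to_int_mod_ring (z $ i))" and nz: "to_int_mod_ring (z $ i) \<noteq> 0" for z
  proof -
    from ev obtain k where "to_int_mod_ring (z $ i) = 2 * k" by (auto elim: evenE)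
    then obtain n where "to_int_mod_ring (z $ i) = 2 * int n" "n \<noteq> 0"
      using to_int_mod_ring_bounds[of "z $ i"] nonneg_int_cases[of k] nz by auto
    then obtain m where m: "to_int_mod_ring (z $ i) = 2 * int (Suc m)"
      by (cases n) auto
    then have "2 * Suc m < CARD('l)" using to_int_mod_ring_bounds[of "z $ i"] by linarith
    then have m2: "2 * m < CARD('l)" by simp
    have z: "z $ i = of_nat (Suc m) + of_nat (Suc m)"
      using of_int_to_int_mod_ring[of "z $ i"] by (simp add: m)
    define v where "v = z - axis i (z $ i)"
    have "v $ i = 0" and v: "v + axis i (z $ i) = z" by (simp_all add: v_def)
    \<comment> \<open>Here a = m + 1 and b = m: the midpoint is the coordinate 2 m + 2 of z, and the
      outer points lie one step to either side. As 2 m + 2 < L, both heights are in the half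
      torus.\<close>
    have "1 + of_nat (Suc m) + of_nat m = z $ i" "1 + of_nat (Suc m) + of_nat (Suc m) = z $ i + 1"
      "1 + of_nat m + of_nat m = z $ i - 1"
      by (simp_all add: z)
    with G_midpoint[OF assms(3) \<open>v $ i = 0\<close> small[OF \<open>2 * Suc m < CARD('l)\<close>] small[OF m2]]
    have "2 * c z \<le> c (axis i (z $ i + 1)) + c (axis i (z $ i - 1))"
      by (simp only: c v)
    then show ?thesis by (simp add: less_eq_complex_def)
  qed
  have mono: "c (y + axis i (of_nat n)) + c (axis i (of_nat n)) \<le> c (y + axis i (of_nat m)) + c (axis i (of_nat m))"
    if y: "y $ i = 0" and mn: "odd m" "odd n" "m \<le> n" "2 * n < CARD('l)" for y and m n :: nat
  proof -
    define f where "f n = c (y + axis i n) + c (axis i n)" for n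
    \<comment> \<open>Odd n below L are written n = 2 s + 1 with s < h = L/2. Then n -> L - n
      becomes s -> h - 1 - s, and 2 n < L becomes 2 s + 1 < h.\<close>
    define g where "g s = f (of_nat (2 * s + 1))" for s :: nat
    from \<open>even CARD('l)\<close> obtain h where h: "CARD('l) = 2 * h" by (auto elim: evenE)
    obtain a b where ab: "m = 2 * a + 1" "n = 2 * b + 1" using mn(1,2) by (auto elim!: oddE)
    have f_minus: "f (- n) = f n" for n
      using G_mirror[OF assms(3) y, of n] G_mirror[OF assms(3), of 0 i n] by (simp add: f_def c)
    have "g b \<le> g a"
    proof (rule convex_symmetric_antimono_complex)
      \<comment> \<open>The heights s and s + 2 have midpoint 1 + s + (s + 2) = 2 (s + 1) + 1, again
        odd; adjacent heights would give an even one.\<close>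
      fix s assume "s + 2 < h"
      then have "2 * s < CARD('l)" "2 * (s + 2) < CARD('l)" using h by auto
      from G_pair_midpoint[OF assms(3) y small[OF this(1)] small[OF this(2)]]
      have "2 * f (1 + of_nat s + of_nat (s + 2)) \<le> f (1 + of_nat s + of_nat s) + f (1 + of_nat (s + 2) + of_nat (s + 2))"
        by (simp only: f_def c)
      then show "2 * g (s + 1) \<le> g s + g (s + 2)"
        by (simp add: g_def ac_simps)
    next
      \<comment> \<open>Here 2 (h - 1 - s) + 1 = L - (2 s + 1), which is -(2 s + 1) modulo L, and
        \<open>f\<close> is even.\<close>
      fix s assume "s < h"
      then have "2 * (h - 1 - s) + 1 + (2 * s + 1) = CARD('l)" using h by simp
      then have "of_nat (2 * (h - 1 - s) + 1) + of_nat (2 * s + 1) = (0 :: 'l mod_ring)"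
        using of_nat_card_eq_0 by (metis of_nat_add)
      then have "of_nat (2 * (h - 1 - s) + 1) = - (of_nat (2 * s + 1) :: 'l mod_ring)"
        by (simp only: eq_neg_iff_add_eq_0)
      then show "g (h - 1 - s) = g s"
        by (simp only: g_def f_minus)
    qed (use mn ab h in auto)
    then show ?thesis by (simp only: g_def f_def ab)
  qed
  show ?thesis
    using odd even mono by (auto simp: monotone_on_def)
qed

end
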